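(* Let $d\ge 2$, let $\mathcal H$ be the class of half-spaces in $\mathbb{R}^d$ (functions $x\mapsto +1$ if $\langle w,x\rangle\ge b$ and $-1$ otherwise, for $w\in\mathbb{R}^d$, $b\in\mathbb{R}$), and let $\epsilon\le 1/3$. Then any protocol that learns $\mathcal H$ in the realizable case with error parameter $\epsilon$ has sample complexity at least $\tilde\Omega(d+\log(1/\epsilon))$.
   Context: Communication model: Let $\mathcal X$ be a domain and $\mathcal Z=\mathcal X\times\{\pm1\}$ the set of examples. A sample is a finite sequence of examples; its size is its length. Alice receives a sample $S_a$ and Bob a sample $S_b$; the joint sample $S=(S_a,S_b)$ is their concatenation and may be split between the parties arbitrarily (adversarially). A deterministic protocol proceeds by messages, each of which is either a single example taken from the sender's own input sample or a single bit; each message depends only on the sender's input and the previous messages, and the output is determined by the sequence of messages. Each transmitted example or bit costs one unit; the sample complexity is the maximum number of units transmitted, as a function of the relevant parameters. For a hypothesis $h:\mathcal X\to\{\pm1\}$, $L_S(h)=\frac{1}{|S|}\sum_{(x,y)\in S}1[h(x)\neq y]$. $S$ is realizable by $\mathcal H$ if $L_S(h)=0$ for some $h\in\mathcal H$. A protocol learns $\mathcal H$ with error $\epsilon$ if on every input sample $S$ it outputs a hypothesis $h$ (not necessarily in $\mathcal H$) with $L_S(h)\le\min_{f\in\mathcal H}L_S(f)+\epsilon$; in the realizable case this is only required for inputs $S$ realizable by $\mathcal H$. Notation: $f\le\tilde O(g)$ means $f\le \alpha g\log g+\beta$ for constants $\alpha,\beta>0$; $\tilde\Omega$ is the analogous lower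 bound hiding logarithmic factors. *)

theory Defs
  imports Complex_Main
begin

(* Labels: True represents +1, False represents -1. *)
type_synonym 'x example = "'x \<times> bool"
type_synonym 'x sample = "'x example list"

datatype 'x msg = Ex "'x example" | Bit bool

datatype party = Alice | Bob

(* A deterministic protocol: who speaks next (None = halt) is determined by the
   transcript; each party's message depends on its own input and the transcript;
   the output hypothesis depends only on the transcript. *)
record 'x protocol =
  turn :: "'x msg list \<Rightarrow> party option"
  amsg :: "'x sample \<Rightarrow> 'x msg list \<Rightarrow> 'x msg"
  bmsg :: "'x sample \<Rightarrow> 'x msg list \<Rightarrow> 'x msg"
  out  :: "'x msg list \<Rightarrow> ('x \<Rightarrow> bool)"

fun trans :: "'x protocol \<Rightarrow> 'x sample \<Rightarrow> 'x sample \<Rightarrow> nat \<Rightarrow> 'x msg list" where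
  "trans P Sa Sb 0 = []"
| "trans P Sa Sb (Suc n) =
     (let t = trans P Sa Sb n in
      case turn P t of
        None \<Rightarrow> t
      | Some Alice \<Rightarrow> t @ [amsg P Sa t]
      | Some Bob \<Rightarrow> t @ [bmsg P Sb t])"

fun msg_ok :: "'x sample \<Rightarrow> 'x msg \<Rightarrow> bool" where
  "msg_ok S (Ex z) = (z \<in> set S)"
| "msg_ok S (Bit b) = True"

definition valid_run :: "'x protocol \<Rightarrow> 'x sample \<Rightarrow> 'x sample \<Rightarrow> bool" where
  "valid_run P Sa Sb \<longleftrightarrow>
     (\<forall>n. let t = trans P Sa Sb n in
        (turn P t = Some Alice \<longrightarrow> msg_ok Sa (amsg P Sa t)) \<and>
        (turn P t = Some Bob \<longrightarrow> msg_ok Sb (bmsg P Sb t)))"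

definition halts_at :: "'x protocol \<Rightarrow> 'x sample \<Rightarrow> 'x sample \<Rightarrow> nat \<Rightarrow> bool" where
  "halts_at P Sa Sb n \<longleftrightarrow> turn P (trans P Sa Sb n) = None"

definition emp_loss :: "'x sample \<Rightarrow> ('x \<Rightarrow> bool) \<Rightarrow> real" where
  "emp_loss S h = real (length (filter (\<lambda>(x, y). h x \<noteq> y) S)) / real (length S)"

definition realizable :: "('x \<Rightarrow> bool) set \<Rightarrow> 'x sample \<Rightarrow> bool" where
  "realizable H S \<longleftrightarrow> (\<exists>h\<in>H. emp_loss S h = 0)"

(* points of R^d are real lists of length d *)
definition in_dom :: "nat \<Rightarrow> real list sample \<Rightarrow> bool" where
  "in_dom d S \<longleftrightarrow> (\<forall>(x, y) \<in> set S. length x = d)"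

definition halfspaces :: "nat \<Rightarrow> (real list \<Rightarrow> bool) set" where
  "halfspaces d = {h. \<exists>w b. length w = d \<and>
      (\<forall>x. h x = ((\<Sum>i<d. w ! i * x ! i) \<ge> b))}"

definition learns_realizable ::
  "nat \<Rightarrow> (real list \<Rightarrow> bool) set \<Rightarrow> real \<Rightarrow> real list protocol \<Rightarrow> bool" where
  "learns_realizable d H eps P \<longleftrightarrow>
     (\<forall>Sa Sb. in_dom d Sa \<and> in_dom d Sb \<longrightarrow>
        valid_run P Sa Sb \<and>
        (realizable H (Sa @ Sb) \<longrightarrow>
           (\<exists>n. halts_at P Sa Sb n \<and> emp_loss (Sa @ Sb) (out P (trans P Sa Sb n)) \<le> eps)))"

end

theory Submission
  imports Defs "HOL-Library.FuncSet"
begin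

text \<open>
  Dependence on \<open>d\<close>: all labellings of the \<open>d\<close> unit vectors are realizable. If Alice holds such a
  sample, each message is one of \<open>2 d + 2\<close>, while each output is within error \<open>1/3\<close> of only an
  exponentially small fraction of the labellings.

  Dependence on \<open>\<epsilon>\<close>: for samples of fewer than \<open>1 / \<epsilon>\<close> points the output must be consistent. Alice
  owns positive and Bob negative points of a set built recursively: tiny flipped copies of the
  previous set are placed along a parabola, one player holding points in all \<open>k\<close> copies and the other
  in only one, in which the roles are then exchanged. Any two inputs meet in at most one point and
  can be separated by a line through it. An adversary follows a transcript with a
  rectangle of inputs, dense in the current copy, and pays two levels of the recursion per message.
  As a message comes from a set of size about \<open>k\<^sup>t\<close> with \<open>t\<close> levels, \<open>k\<close> of order \<open>t log k\<close> suffices,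
  so \<open>t\<close> may be of order \<open>log (1 / \<epsilon>) / log log (1 / \<epsilon>)\<close>.
\<close>

section \<open>The recursive point set\<close>

text \<open>
  The hard inputs form a tree game in which the player with a \<open>Branch\<close> holds \<open>k\<close> subinstances
  and the player with a \<open>Pick\<close> selects one of them; in the selected subinstance the roles are
  exchanged. The bit at a leaf says whether the player owns the point of that leaf.
\<close>

datatype strat = Leaf bool | Branch "nat \<Rightarrow> strat" | Pick nat strat

fun branchers :: "nat \<Rightarrow> nat \<Rightarrow> strat set" and pickers :: "nat \<Rightarrow> nat \<Rightarrow> strat set" where
  "branchers k 0 = range Leaf"
| "branchers k (Suc t) = Branch ` ({..<k} \<rightarrow>\<^sub>E pickers k t)"
| "pickers k 0 = range Leaf"
| "pickers k (Suc t) = (\<lambda>(j, w). Pick j w) ` ({..<k} \<times> branchers k t)"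

primrec leaf_bit :: "strat \<Rightarrow> strat \<Rightarrow> bool" where
  "leaf_bit (Leaf x) v = x"
| "leaf_bit (Branch f) v = (case v of Pick j w \<Rightarrow> leaf_bit (f j) w | _ \<Rightarrow> False)"
| "leaf_bit (Pick j w) v = (case v of Branch f \<Rightarrow> leaf_bit w (f j) | _ \<Rightarrow> False)"

text \<open>
  A shrunken copy of the plane around the point \<open>(a, a\<^sup>2)\<close> of a parabola, sheared along the tangent
  and flipped, since the players exchange roles. The factors \<open>g / 8\<close> and \<open>g\<^sup>2 / 64\<close> keep every line of
  slope at most 1 in the copy so close to the tangent that all other copies lie above it.
\<close>

fun cluster :: "nat \<Rightarrow> nat \<Rightarrow> real \<times> real \<Rightarrow> real \<times> real" where
  "cluster k j (x, y) =
     (let g = 1 / (4 * real k); a = real j * g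
      in (a + g / 8 * x, a\<^sup>2 + 2 * a * (g / 8) * x - g\<^sup>2 / 64 * y))"

text \<open>The location of the leaf reached when the two strategies are played against each other,
  whether or not anyone owns it. Combinations of shapes that do not arise in play get a default
  value.\<close>

primrec meet :: "nat \<Rightarrow> strat \<Rightarrow> strat \<Rightarrow> real \<times> real" where
  "meet k (Leaf x) v = (0, 0)"
| "meet k (Branch f) v = (case v of Pick j w \<Rightarrow> cluster k j (meet k (f j) w) | _ \<Rightarrow> (0, 0))"
| "meet k (Pick j w) v = (case v of Branch f \<Rightarrow> cluster k j (meet k w (f j)) | _ \<Rightarrow> (0, 0))"

primrec points :: "nat \<Rightarrow> strat \<Rightarrow> (real \<times> real) list" where
  "points k (Leaf x) = (if x then [(0, 0)] else [])"
| "points k (Branch f) = concat (map (\<lambda>j. map (cluster k j) (points k (f j))) [0..<k])"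
| "points k (Pick j w) = map (cluster k j) (points k w)"

text \<open>All locations that any strategy could own. Its size bounds the number of distinct
  examples that can be sent.\<close>

primrec grid :: "nat \<Rightarrow> nat \<Rightarrow> (real \<times> real) set" where
  "grid k 0 = {(0, 0)}"
| "grid k (Suc t) = (\<Union>j<k. cluster k j ` grid k t)"

section \<open>Counting strategies and their points\<close>

lemma branchers_SucE:
  assumes "u \<in> branchers k (Suc t)"
  obtains f where "u = Branch f" "\<And>j. j < k \<Longrightarrow> f j \<in> pickers k t"
  using assms by (auto simp: PiE_def Pi_def)

lemma pickers_SucE:
  assumes "v \<in> pickers k (Suc t)"
  obtains j w where "v = Pick j w" "j < k" "w \<in> branchers k t"
  using assms by auto

lemma finite_strats: "finite (branchers k t)" "finite (pickers k t)"
proof -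
  have "finite (branchers k t) \<and> finite (pickers k t)"
    by (induction t) (auto intro!: finite_imageI finite_PiE)
  then show "finite (branchers k t)" "finite (pickers k t)" by auto
qed

lemma card_branchers_Suc: "card (branchers k (Suc t)) = card (pickers k t) ^ k"
  by (simp add: card_image inj_on_def card_PiE)

lemma card_pickers_Suc: "card (pickers k (Suc t)) = k * card (branchers k t)"
  by (simp add: card_image inj_on_def card_cartesian_product)

lemma card_strats_pos:
  assumes "0 < k" shows "0 < card (branchers k t)" "0 < card (pickers k t)"
proof -
  have "0 < card (branchers k t) \<and> 0 < card (pickers k t)"
  proof (induction t)
    case 0
    then show ?case by (simp add: card_gt_0_iff)
  next
    case (Suc t)
    then show ?case using assms by (simp only: card_branchers_Suc card_pickers_Suc) simp
  qed
  then show "0 < card (branchers k t)" "0 < card (pickers k t)" by auto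
qed

lemma finite_grid: "finite (grid k t)"
  by (induction t) auto

lemma card_grid: "card (grid k t) \<le> k ^ t"
proof (induction t)
  case (Suc t)
  have "card (grid k (Suc t)) \<le> (\<Sum>j<k. card (cluster k j ` grid k t))"
    by (simp add: card_UN_le)
  also have "\<dots> \<le> (\<Sum>j<k. k ^ t)"
    using Suc finite_grid by (intro sum_mono) (meson card_image_le order_trans)
  finally show ?case by simp
qed simp

lemma points_grid:
  "u \<in> branchers k t \<or> u \<in> pickers k t \<Longrightarrow> set (points k u) \<subseteq> grid k t"
proof (induction t arbitrary: u)
  case (Suc t)
  then show ?case by (fastforce simp: PiE_def Pi_def)
qed (auto split: if_splits)

lemma length_points:
  assumes "0 < k" "u \<in> branchers k t \<or> u \<in> pickers k t"
  shows "length (points k u) \<le> k ^ t"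
  using assms(2)
proof (induction t arbitrary: u)
  case (Suc t)
  show ?case
  proof (cases "u \<in> branchers k (Suc t)")
    case True
    then obtain f where u: "u = Branch f" and f: "\<And>j. j < k \<Longrightarrow> f j \<in> pickers k t" by auto
    have "length (points k u) = (\<Sum>j<k. length (points k (f j)))"
      by (simp add: u length_concat o_def interv_sum_list_conv_sum_set_nat lessThan_atLeast0)
    also have "\<dots> \<le> (\<Sum>j<k. k ^ t)"
      using Suc.IH f by (intro sum_mono) auto
    finally show ?thesis by simp
  next
    case False
    then obtain j w where "u = Pick j w" "w \<in> branchers k t" using Suc.prems by auto
    then have "length (points k u) \<le> k ^ t" using Suc.IH by auto
    also have "\<dots> \<le> k ^ Suc t" using assms(1) by simp
    finally show ?thesis .
  qed
qed (auto split: if_splits)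

lemma meet_in_points:
  assumes "u \<in> branchers k t" "v \<in> pickers k t"
  shows "leaf_bit u v \<Longrightarrow> meet k u v \<in> set (points k u)"
    and "leaf_bit v u \<Longrightarrow> meet k u v \<in> set (points k v)"
proof -
  \<comment> \<open>Symmetry of \<open>meet\<close> joins the induction because the roles are
    exchanged at every level.\<close>
  have "meet k u v = meet k v u \<and> (leaf_bit u v \<longrightarrow> meet k u v \<in> set (points k u)) \<and>
      (leaf_bit v u \<longrightarrow> meet k u v \<in> set (points k v))"
    using assms
  proof (induction t arbitrary: u v)
    case (Suc t)
    then obtain f j w where *: "u = Branch f" "v = Pick j w" "j < k" "f j \<in> pickers k t"
      "w \<in> branchers k t"
      by (metis branchers_SucE pickers_SucE)
    show ?case using Suc.IH[OF *(5,4)] * by force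
  qed auto
  then show "leaf_bit u v \<Longrightarrow> meet k u v \<in> set (points k u)"
    "leaf_bit v u \<Longrightarrow> meet k u v \<in> set (points k v)" by auto
qed

section \<open>Geometry of the copies and the separating line\<close>

lemma grid_bounded:
  assumes "0 < k" "(x, y) \<in> grid k t"
  shows "\<bar>x\<bar> \<le> 1 \<and> \<bar>y\<bar> \<le> 1"
  using assms(2)
proof (induction t arbitrary: x y)
  case (Suc t)
  then obtain j x' y' where j: "j < k" and in': "(x', y') \<in> grid k t"
    and xy: "(x, y) = cluster k j (x', y')" by auto
  define g where "g = 1 / (4 * real k)"
  define a where "a = real j * g"
  have g: "0 < g" "g \<le> 1/4" using assms(1) by (auto simp: g_def field_simps)
  have a: "0 \<le> a" "a \<le> 1/4" using j g by (auto simp: a_def g_def field_simps)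
  have b: "\<bar>x'\<bar> \<le> 1" "\<bar>y'\<bar> \<le> 1" using Suc.IH[OF in'] by auto
  have x: "x = a + g / 8 * x'" and y: "y = a\<^sup>2 + 2 * a * (g / 8) * x' - g\<^sup>2 / 64 * y'"
    using xy by (auto simp: g_def a_def Let_def)
  have gx: "\<bar>g * x'\<bar> \<le> 1/4" using mult_mono[of "g" "1/4" "\<bar>x'\<bar>" 1] g b by (simp add: abs_mult)
  have agx: "\<bar>a * (g * x')\<bar> \<le> 1/4 * (1/4)"
    using mult_mono[of "a" "1/4" "\<bar>g * x'\<bar>" "1/4"] gx a by (simp add: abs_mult)
  have a2: "a\<^sup>2 \<le> 1/16" "0 \<le> a\<^sup>2" using power_mono[of a "1/4" 2] a by (auto simp: power2_eq_square)
  have g2: "g\<^sup>2 \<le> 1/16" "0 \<le> g\<^sup>2" using power_mono[of g "1/4" 2] g by (auto simp: power2_eq_square)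
  have gy: "\<bar>g\<^sup>2 * y'\<bar> \<le> 1/16" using mult_mono[of "g\<^sup>2" "1/16" "\<bar>y'\<bar>" 1] g2 b by (simp add: abs_mult)
  have "\<bar>x\<bar> \<le> 1" using gx a unfolding x by argo
  moreover have "y = a\<^sup>2 + (a * (g * x')) / 4 - (g\<^sup>2 * y') / 64" unfolding y by simp
  then have "\<bar>y\<bar> \<le> 1" using agx a2 gy by argo
  ultimately show ?case by simp
qed auto

text \<open>The line is the image of y = s x + c in the copy at \<open>a\<close>; the point lies in
  the copy at \<open>a'\<close>. With D = a' - a, convexity of the parabola gives a gap of D^2,
  while shear, slope and offsets change it by at most (1/4 + 1/8 + 3/64) D^2.\<close>

lemma other_cluster_above:
  fixes a a' g s c x y :: real
  assumes g: "0 < g" and gap: "g \<le> \<bar>a' - a\<bar>"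
    and b: "\<bar>x\<bar> \<le> 1" "\<bar>y\<bar> \<le> 1" "\<bar>s\<bar> \<le> 1" "\<bar>c\<bar> \<le> 1"
  shows "a'\<^sup>2 + 2 * a' * (g / 8) * x - g\<^sup>2 / 64 * y >
         (2 * a - g / 8 * s) * (a' + g / 8 * x) + (- a\<^sup>2 + g / 8 * s * a - g\<^sup>2 / 64 * c)"
proof -
  define D where "D = a' - a"
  have eq: "a'\<^sup>2 + 2 * a' * (g / 8) * x - g\<^sup>2 / 64 * y
      - ((2 * a - g / 8 * s) * (a' + g / 8 * x) + (- a\<^sup>2 + g / 8 * s * a - g\<^sup>2 / 64 * c))
      = D\<^sup>2 + (g * D * x) / 4 + (g * D * s) / 8 + (g\<^sup>2 * (s * x)) / 64 - (g\<^sup>2 * y) / 64 + (g\<^sup>2 * c) / 64"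
    unfolding D_def by (simp add: power2_eq_square field_simps)
  have gD: "\<bar>g * D\<bar> \<le> D\<^sup>2"
    using mult_right_mono[of g "\<bar>D\<bar>" "\<bar>D\<bar>"] gap g by (simp add: D_def abs_mult power2_eq_square)
  have g2: "g\<^sup>2 \<le> D\<^sup>2" using power_mono[of g "\<bar>D\<bar>" 2] gap g by (simp add: D_def)
  have D: "0 < D\<^sup>2" using gap g by (auto simp: D_def)
  have bd: "\<bar>p * z\<bar> \<le> D\<^sup>2" if "\<bar>p\<bar> \<le> D\<^sup>2" "\<bar>z\<bar> \<le> 1" for p z :: real
    using mult_mono[OF that] by (simp add: abs_mult)
  have "\<bar>s * x\<bar> \<le> 1" using mult_mono[of "\<bar>s\<bar>" 1 "\<bar>x\<bar>" 1] b by (simp add: abs_mult)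
  then have "\<bar>g\<^sup>2 * (s * x)\<bar> \<le> D\<^sup>2" "\<bar>g\<^sup>2 * y\<bar> \<le> D\<^sup>2" "\<bar>g\<^sup>2 * c\<bar> \<le> D\<^sup>2"
    "\<bar>g * D * x\<bar> \<le> D\<^sup>2" "\<bar>g * D * s\<bar> \<le> D\<^sup>2"
    using bd gD g2 b by auto
  then show ?thesis using D eq by argo
qed

text \<open>A line for the selected subinstance with exchanged roles is carried over by
  \<open>cluster\<close>, whose flip puts the brancher above again; the brancher's other copies lie
  above it anyway. The bounds on slope and intercept keep the induction going.\<close>

lemma separating_line:
  assumes "0 < k" "u \<in> branchers k t" "v \<in> pickers k t"
  shows "\<exists>s c. \<bar>s\<bar> \<le> 1 \<and> \<bar>c\<bar> \<le> 1 \<and>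
    (\<forall>(x, y)\<in>set (points k u). y > s * x + c \<or> leaf_bit u v \<and> y = s * x + c) \<and>
    (\<forall>(x, y)\<in>set (points k v). y < s * x + c \<or> leaf_bit v u \<and> y = s * x + c)"
  using assms(2,3)
proof (induction t arbitrary: u v)
  case 0
  then show ?case by (intro exI[of _ 0]) (auto split: if_splits)
next
  case (Suc t)
  then obtain f j w where u: "u = Branch f" and v: "v = Pick j w" and j: "j < k"
    and f: "\<And>i. i < k \<Longrightarrow> f i \<in> pickers k t" and w: "w \<in> branchers k t"
    by (metis branchers_SucE pickers_SucE)
  \<comment> \<open>Inside copy \<open>j\<close> the picker is the branching player, so
    \<open>w\<close> takes the upper side.\<close>
  from Suc.IH[OF w f[OF j]] obtain s c where b: "\<bar>s\<bar> \<le> 1" "\<bar>c\<bar> \<le> 1"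
    and above: "\<And>x y. (x, y)\<in>set (points k w) \<Longrightarrow> y > s * x + c \<or> leaf_bit w (f j) \<and> y = s * x + c"
    and below: "\<And>x y. (x, y)\<in>set (points k (f j)) \<Longrightarrow> y < s * x + c \<or> leaf_bit (f j) w \<and> y = s * x + c"
    by blast
  define g where "g = 1 / (4 * real k)"
  define a where "a = real j * g"
  define s' where "s' = 2 * a - g / 8 * s"
  define c' where "c' = - a\<^sup>2 + g / 8 * s * a - g\<^sup>2 / 64 * c"
  have g: "0 < g" "g \<le> 1/4" using assms(1) by (auto simp: g_def field_simps)
  have a: "0 \<le> a" "a \<le> 1/4" using j g by (auto simp: a_def g_def field_simps)
  have a2: "a\<^sup>2 \<le> 1/16" "0 \<le> a\<^sup>2" using power_mono[of a "1/4" 2] a by (auto simp: power2_eq_square)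
  have g2: "g\<^sup>2 \<le> 1/16" "0 < g\<^sup>2" using power_mono[of g "1/4" 2] g by (auto simp: power2_eq_square)
  have gs: "\<bar>g * s\<bar> \<le> 1/4" using mult_mono[of "g" "1/4" "\<bar>s\<bar>" 1] g b by (simp add: abs_mult)
  have gsa: "\<bar>g * s * a\<bar> \<le> 1/4 * (1/4)"
    using mult_mono[of "\<bar>g * s\<bar>" "1/4" "a" "1/4"] gs a by (simp add: abs_mult)
  have gc: "\<bar>g\<^sup>2 * c\<bar> \<le> 1/16" using mult_mono[of "g\<^sup>2" "1/16" "\<bar>c\<bar>" 1] g2 b by (simp add: abs_mult)
  have s': "\<bar>s'\<bar> \<le> 1" using gs a unfolding s'_def by argo
  have "c' = - a\<^sup>2 + (g * s * a) / 8 - (g\<^sup>2 * c) / 64" unfolding c'_def by simp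
  then have c': "\<bar>c'\<bar> \<le> 1" using gsa a2 gc by argo
  \<comment> \<open>\<open>cluster\<close> maps the inner line onto the line given by
    \<open>s'\<close> and \<open>c'\<close>, exchanging its two sides.\<close>
  have flip: "Y - (s' * X + c') = g\<^sup>2 / 64 * (s * x + c - y)"
    if "(X, Y) = cluster k j (x, y)" for X Y x y
  proof -
    have X: "X = a + g / 8 * x" and Y: "Y = a\<^sup>2 + 2 * a * (g / 8) * x - g\<^sup>2 / 64 * y"
      using that by (auto simp: a_def g_def Let_def)
    show ?thesis unfolding s'_def c'_def X Y by (simp add: power2_eq_square field_simps)
  qed
  have 1: "Y > s' * X + c' \<or> leaf_bit u v \<and> Y = s' * X + c'" if XY: "(X, Y) \<in> set (points k u)" for X Y
  proof -
    from XY obtain i x y where i: "i < k" and xy: "(x, y) \<in> set (points k (f i))"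
      and C: "(X, Y) = cluster k i (x, y)" unfolding u by auto
    show ?thesis
    proof (cases "i = j")
      case True
      have "y < s * x + c \<or> leaf_bit (f j) w \<and> y = s * x + c" using below xy True by simp
      then show ?thesis
      proof
        assume "y < s * x + c"
        then have "0 < g\<^sup>2 / 64 * (s * x + c - y)" using g2 by simp
        then show ?thesis using flip[OF C[unfolded True]] by simp
      next
        assume "leaf_bit (f j) w \<and> y = s * x + c"
        then have "s * x + c - y = 0" "leaf_bit u v" using u v by simp_all
        then show ?thesis using flip[OF C[unfolded True]] by simp
      qed
    next
      case False
      define a' where "a' = real i * g"
      have "1 \<le> \<bar>real i - real j\<bar>" using False by linarith
      then have gap: "g \<le> \<bar>a' - a\<bar>"
        using mult_right_mono[of 1 "\<bar>real i - real j\<bar>" g] g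
        by (simp add: a_def a'_def abs_mult left_diff_distrib[symmetric])
      have "(x, y) \<in> grid k t" using points_grid[of "f i" k t] f[OF i] xy by auto
      then have bxy: "\<bar>x\<bar> \<le> 1" "\<bar>y\<bar> \<le> 1" using grid_bounded[OF assms(1)] by auto
      have "X = a' + g / 8 * x" "Y = a'\<^sup>2 + 2 * a' * (g / 8) * x - g\<^sup>2 / 64 * y"
        using C by (auto simp: a'_def g_def Let_def)
      then have "Y > s' * X + c'"
        using other_cluster_above[OF g(1) gap bxy b] by (simp add: s'_def c'_def)
      then show ?thesis by simp
    qed
  qed
  have 2: "Y < s' * X + c' \<or> leaf_bit v u \<and> Y = s' * X + c'" if XY: "(X, Y) \<in> set (points k v)" for X Y
  proof -
    from XY obtain x y where xy: "(x, y) \<in> set (points k w)"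
      and C: "(X, Y) = cluster k j (x, y)" unfolding v by auto
    from above[OF xy] show ?thesis
    proof
      assume "y > s * x + c"
      then have "g\<^sup>2 / 64 * (s * x + c - y) < 0" using g2 by (simp add: mult_less_0_iff)
      then show ?thesis using flip[OF C] by simp
    next
      assume "leaf_bit w (f j) \<and> y = s * x + c"
      then have "s * x + c - y = 0" "leaf_bit v u" using u v by simp_all
      then show ?thesis using flip[OF C] by simp
    qed
  qed
  show ?case using s' c' 1 2 by (intro exI[of _ s'] exI[of _ c']) auto
qed

section \<open>The adversary\<close>

text \<open>
  Two pairs of inputs meeting in the same point, which is owned by the first player in one pair and
  by the second player in the other: no single hypothesis labels that point correctly for both.
\<close>

fun conflict :: "nat \<Rightarrow> strat \<times> strat \<Rightarrow> strat \<times> strat \<Rightarrow> bool" where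
  "conflict k (u, v) (u', v') \<longleftrightarrow>
     leaf_bit u v \<and> \<not> leaf_bit v u \<and> \<not> leaf_bit u' v' \<and> leaf_bit v' u' \<and>
     meet k u v = meet k u' v' \<and> meet k v u = meet k v' u'"

text \<open>
  \<open>A\<close> and \<open>B\<close> are the remaining inputs of the two players, and \<open>pa\<close> and \<open>pb\<close> extract their parts in
  the current subinstance; density is measured among these parts only.
\<close>

definition dense ::
  "nat \<Rightarrow> real \<Rightarrow> nat \<Rightarrow> 'a set \<Rightarrow> ('a \<Rightarrow> strat) \<Rightarrow> 'b set \<Rightarrow> ('b \<Rightarrow> strat) \<Rightarrow> bool" where
  "dense k \<alpha> t A pa B pb \<longleftrightarrow>
     pa ` A \<subseteq> branchers k t \<and> pb ` B \<subseteq> pickers k t \<and>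
     \<alpha> * real (card (branchers k t)) \<le> real (card (pa ` A)) \<and>
     3 / 4 * real (card (pickers k t)) \<le> real (card (pb ` B))"

lemma dense_mem:
  assumes "dense k \<alpha> t A pa B pb"
  shows "a \<in> A \<Longrightarrow> pa a \<in> branchers k t" "b \<in> B \<Longrightarrow> pb b \<in> pickers k t"
  using assms unfolding dense_def by blast+

text \<open>One projection serves both players: it evaluates a branching strategy at
  \<open>j\<close> and strips the choice from a picking one.\<close>

primrec branch :: "nat \<Rightarrow> strat \<Rightarrow> strat" where
  "branch j (Leaf x) = Leaf x"
| "branch j (Branch f) = f j"
| "branch j (Pick i w) = w"

primrec picked :: "strat \<Rightarrow> nat" where
  "picked (Leaf x) = 0"
| "picked (Branch f) = 0"
| "picked (Pick i w) = i"

text \<open>Lifts a conflict out of a subinstance. As the players are exchanged there, the pair in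
  which the first player owns the point comes second after lifting, so the two pairs change
  places.\<close>

lemma conflict_descend:
  assumes "u \<in> branchers k (Suc t)" "u' \<in> branchers k (Suc t)"
    and "v \<in> pickers k (Suc t)" "v' \<in> pickers k (Suc t)" "picked v = j" "picked v' = j"
    and "conflict k (branch j v, branch j u) (branch j v', branch j u')"
  shows "conflict k (u', v') (u, v)"
  using assms by (auto elim!: branchers_SucE pickers_SucE simp del: branchers.simps pickers.simps)

text \<open>\<open>X\<close> lies in the product of its coordinate projections, and each bad
  coordinate costs that product a factor \<open>\<theta>\<close>.\<close>

lemma card_product_le:
  fixes X :: "(nat \<Rightarrow> 'b) set"
  assumes X: "X \<subseteq> {..<k} \<rightarrow>\<^sub>E V" and V: "finite V" and \<theta>: "0 \<le> \<theta>" "\<theta> \<le> 1"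
  defines "Bad \<equiv> {j\<in>{..<k}. real (card ((\<lambda>f. f j) ` X)) < \<theta> * real (card V)}"
  shows "real (card X) \<le> \<theta> ^ card Bad * real (card V) ^ k"
proof -
  have sub: "(\<lambda>f. f j) ` X \<subseteq> V" if "j < k" for j
    using X that by (auto simp: PiE_def Pi_def)
  then have fin: "finite ((\<lambda>f. f j) ` X)" if "j < k" for j
    using V that finite_subset by blast
  have "X \<subseteq> PiE {..<k} (\<lambda>j. (\<lambda>f. f j) ` X)"
    using X by (auto simp: PiE_def Pi_def)
  then have "card X \<le> card (PiE {..<k} (\<lambda>j. (\<lambda>f. f j) ` X))"
    using fin by (intro card_mono finite_PiE) auto
  also have "\<dots> = (\<Prod>j<k. card ((\<lambda>f. f j) ` X))" by (simp add: card_PiE)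
  finally have "real (card X) \<le> (\<Prod>j<k. real (card ((\<lambda>f. f j) ` X)))"
    by (metis of_nat_le_iff of_nat_prod)
  also have "\<dots> \<le> (\<Prod>j<k. (if j \<in> Bad then \<theta> else 1) * real (card V))"
    using sub V by (intro prod_mono) (auto simp: Bad_def card_mono)
  also have "\<dots> = (\<Prod>j<k. if j \<in> Bad then \<theta> else 1) * real (card V) ^ k"
    by (simp add: prod.distrib)
  also have "(\<Prod>j<k. if j \<in> Bad then \<theta> else 1) = \<theta> ^ card Bad"
    by (subst prod.If_cases) (auto simp: Bad_def Int_def intro!: arg_cong[where f = card])
  finally show ?thesis .
qed

text \<open>
  A set of density more than \<open>(3/4)\<^sup>q\<close> in a product of \<open>k = 8 q\<close> factors projects to density below
  \<open>3/4\<close> in at most \<open>k / 8\<close> coordinates. As \<open>3/4 - 1/8 = 5/8\<close>, some other branch still carries density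
  \<open>5/8\<close> of the picker's inputs.
\<close>

lemma dense_descend:
  assumes d: "dense k \<alpha> (Suc t) A pa B pb"
    and k: "k = 8 * q" "0 < q" and \<alpha>: "(3/4) ^ q < \<alpha>"
  obtains j where
    "dense k (5/8) t {b\<in>B. picked (pb b) = j} (branch j \<circ> pb) A (branch j \<circ> pa)"
proof -
  have kpos: "0 < k" using k by simp
  let ?N = "card (pickers k t)" and ?U = "card (branchers k t)"
  note pos = card_strats_pos[OF kpos, of t]
  have A: "pa ` A \<subseteq> Branch ` ({..<k} \<rightarrow>\<^sub>E pickers k t)"
    and B: "pb ` B \<subseteq> (\<lambda>(j, w). Pick j w) ` ({..<k} \<times> branchers k t)"
    using d by (auto simp: dense_def)
  define X where "X = {f. Branch f \<in> pa ` A}"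
  have paA: "pa ` A = Branch ` X"
  proof (intro equalityI subsetI)
    fix u assume u: "u \<in> pa ` A"
    with A obtain f where "u = Branch f" by (meson imageE subsetD)
    with u show "u \<in> Branch ` X" by (simp add: X_def)
  qed (auto simp: X_def)
  have X: "X \<subseteq> {..<k} \<rightarrow>\<^sub>E pickers k t"
    using A unfolding paA by (simp add: inj_image_subset_iff inj_def)
  have cX: "card (pa ` A) = card X" unfolding paA by (simp add: card_image inj_on_def)
  define Y where "Y = (\<lambda>j. {w. Pick j w \<in> pb ` B})"
  have Y: "Y j \<subseteq> branchers k t" for j
  proof
    fix w assume "w \<in> Y j"
    then have "Pick j w \<in> (\<lambda>(j, w). Pick j w) ` ({..<k} \<times> branchers k t)"
      using B unfolding Y_def by (meson mem_Collect_eq subsetD)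
    then show "w \<in> branchers k t" by auto
  qed
  then have finY: "finite (Y j)" for j using finite_strats finite_subset by blast
  have cYU: "card (Y j) \<le> ?U" for j using Y finite_strats by (simp add: card_mono)
  have "pb ` B = (\<lambda>(j, w). Pick j w) ` (SIGMA j:{..<k}. Y j)"
  proof (intro equalityI subsetI)
    fix v assume v: "v \<in> pb ` B"
    with B have "v \<in> (\<lambda>(j, w). Pick j w) ` ({..<k} \<times> branchers k t)" by (rule subsetD)
    then obtain j w where "v = Pick j w" "j < k" by auto
    with v show "v \<in> (\<lambda>(j, w). Pick j w) ` (SIGMA j:{..<k}. Y j)"
      by (intro image_eqI[where x = "(j, w)"]) (simp_all add: Y_def)
  qed (auto simp: Y_def)
  then have cY: "card (pb ` B) = (\<Sum>j<k. card (Y j))"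
    using finY by (simp add: card_image inj_on_def)
  define Bad where "Bad = {j\<in>{..<k}. real (card ((\<lambda>f. f j) ` X)) < 3/4 * real ?N}"
  have Bad: "card Bad \<le> q"
  proof (rule ccontr)
    assume "\<not> card Bad \<le> q"
    then have "(3/4 :: real) ^ card Bad \<le> (3/4) ^ q" by (intro power_decreasing) auto
    then have *: "(3/4 :: real) ^ card Bad < \<alpha>" using \<alpha> by linarith
    have "\<alpha> * real (?N ^ k) \<le> real (card X)"
      using d cX unfolding dense_def card_branchers_Suc by simp
    also have "\<dots> \<le> (3/4) ^ card Bad * real ?N ^ k"
      unfolding Bad_def by (rule card_product_le) (use X finite_strats in auto)
    finally have "\<alpha> \<le> (3/4) ^ card Bad" using pos by simp
    with * show False by simp
  qed
  have "\<exists>j<k. j \<notin> Bad \<and> 5/8 * real ?U \<le> real (card (Y j))"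
  proof (rule ccontr)
    assume "\<not> ?thesis"
    then have small: "real (card (Y j)) \<le> 5/8 * real ?U" if "j < k" "j \<notin> Bad" for j
      using that by (meson less_eq_real_def not_le)
    have "3/4 * (real k * real ?U) \<le> real (card (pb ` B))"
      using d unfolding dense_def card_pickers_Suc by simp
    also have "\<dots> = (\<Sum>j<k. real (card (Y j)))" by (simp add: cY)
    \<comment> \<open>A bad branch may be full, exceeding 5/8 by 3/8. With at most k/8 bad branches
      the total density stays below 5/8 + 3/64 < 3/4.\<close>
    also have "\<dots> \<le> (\<Sum>j<k. 5/8 * real ?U + (if j \<in> Bad then 3/8 * real ?U else 0))"
      using small cYU by (intro sum_mono) auto
    also have "\<dots> = 5/8 * real k * real ?U + real (card Bad) * (3/8 * real ?U)"
      by (simp add: sum.distrib sum.If_cases Bad_def Int_def)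
    also have "\<dots> \<le> 5/8 * real k * real ?U + real q * (3/8 * real ?U)"
      using Bad by (intro add_left_mono mult_right_mono) auto
    finally have "6 * (real q * real ?U) \<le> 5 * (real q * real ?U) + 3/8 * (real q * real ?U)"
      by (simp add: k algebra_simps)
    moreover have "0 < real q * real ?U" using k pos by simp
    ultimately show False by argo
  qed
  then obtain j where j: "j < k" "j \<notin> Bad" "5/8 * real ?U \<le> real (card (Y j))" by blast
  have 1: "(branch j \<circ> pb) ` {b\<in>B. picked (pb b) = j} = Y j"
  proof
    show "(branch j \<circ> pb) ` {b\<in>B. picked (pb b) = j} \<subseteq> Y j"
    proof
      fix w assume "w \<in> (branch j \<circ> pb) ` {b\<in>B. picked (pb b) = j}"
      then obtain b where b: "b \<in> B" "picked (pb b) = j" "w = branch j (pb b)" by auto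
      obtain w' where "pb b = Pick j w'" using subsetD[OF B imageI[OF b(1)]] b(2) by auto
      then show "w \<in> Y j" using b by (auto simp: Y_def intro!: image_eqI[where x = b])
    qed
    show "Y j \<subseteq> (branch j \<circ> pb) ` {b\<in>B. picked (pb b) = j}"
    proof
      fix w assume "w \<in> Y j"
      then obtain b where "b \<in> B" "Pick j w = pb b" by (auto simp: Y_def)
      then show "w \<in> (branch j \<circ> pb) ` {b\<in>B. picked (pb b) = j}"
        by (intro image_eqI[where x = b]) (auto simp: \<open>Pick j w = pb b\<close>[symmetric])
    qed
  qed
  have "(branch j \<circ> pa) ` A = branch j ` Branch ` X" by (metis image_comp paA)
  also have "\<dots> = (\<lambda>f. f j) ` X" by (simp add: image_image)
  finally have 2: "(branch j \<circ> pa) ` A = (\<lambda>f. f j) ` X" .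
  have "(\<lambda>f. f j) ` X \<subseteq> pickers k t" using X j(1) by (auto simp: PiE_def Pi_def)
  then have "dense k (5/8) t {b\<in>B. picked (pb b) = j} (branch j \<circ> pb) A (branch j \<circ> pa)"
    unfolding dense_def 1 2 using Y j by (auto simp: Bad_def not_less)
  then show ?thesis by (rule that)
qed

lemma mem_if_card_gt_1:
  assumes S: "S \<subseteq> range Leaf" and c: "1 < card S"
  shows "Leaf x \<in> S"
proof (rule ccontr)
  assume "Leaf x \<notin> S"
  have "s = Leaf (\<not> x)" if s: "s \<in> S" for s
  proof -
    obtain y where y: "s = Leaf y" using S s by blast
    have "y \<noteq> x"
    proof
      assume "y = x"
      then show False using y s \<open>Leaf x \<notin> S\<close> by simp
    qed
    then have "y = (\<not> x)" by simp
    then show ?thesis using y by (rule back_subst[where P = "\<lambda>b. s = Leaf b", rotated])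
  qed
  then have "S \<subseteq> {Leaf (\<not> x)}" by blast
  then show False using c card_mono[of "{Leaf (\<not> x)}" S] by simp
qed

lemma dense_conflict:
  fixes A B :: "'a set"
  assumes "dense k (5/8) t A pa B pb" and k: "k = 8 * q" "0 < q" and q: "(3/4 :: real) ^ q < 5/8"
  shows "\<exists>a\<in>A. \<exists>a'\<in>A. \<exists>b\<in>B. \<exists>b'\<in>B. conflict k (pa a, pb b) (pa a', pb b')"
  using assms(1)
proof (induction t arbitrary: A B pa pb)
  case 0
  have "inj Leaf" by (simp add: inj_def)
  \<comment> \<open>With only two leaves, any density above 1/2 forces both to be present.\<close>
  then have "card (range Leaf) = 2" by (simp add: card_image)
  then have "pa ` A \<subseteq> range Leaf" "pb ` B \<subseteq> range Leaf" "1 < card (pa ` A)" "1 < card (pb ` B)"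
    using 0 by (auto simp: dense_def)
  then have full: "Leaf x \<in> pa ` A" "Leaf x \<in> pb ` B" for x
    using mem_if_card_gt_1 by blast+
  obtain a a' where a: "a \<in> A" "a' \<in> A" "pa a = Leaf True" "pa a' = Leaf False"
    using full(1)[of True] full(1)[of False] by (metis imageE)
  obtain b b' where b: "b \<in> B" "b' \<in> B" "pb b = Leaf False" "pb b' = Leaf True"
    using full(2)[of True] full(2)[of False] by (metis imageE)
  have "conflict k (pa a, pb b) (pa a', pb b')" using a b by simp
  then show ?case using a b by blast
next
  case (Suc t)
  obtain j where j: "dense k (5/8) t {b\<in>B. picked (pb b) = j} (branch j \<circ> pb) A (branch j \<circ> pa)"
    using dense_descend[OF Suc.prems k q] .
  from Suc.IH[OF j] obtain b b' a a' where
    *: "a \<in> A" "a' \<in> A" "b \<in> B" "b' \<in> B" "picked (pb b) = j" "picked (pb b') = j"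
    "conflict k (branch j (pb b), branch j (pa a)) (branch j (pb b'), branch j (pa a'))"
    by auto
  have "conflict k (pa a', pb b') (pa a, pb b)"
    by (rule conflict_descend[OF _ _ _ _ *(5-7)]) (use dense_mem[OF Suc.prems] * in blast)+
  with * show ?case by blast
qed

section \<open>Exchanging the players and following a transcript\<close>

fun other :: "party \<Rightarrow> party" where
  "other Alice = Bob"
| "other Bob = Alice"

text \<open>Renaming the players lets the branching player be Alice at every level of the
  recursion.\<close>

definition swap :: "'x protocol \<Rightarrow> 'x protocol" where
  "swap P = \<lparr>turn = map_option other \<circ> turn P, amsg = bmsg P, bmsg = amsg P, out = out P\<rparr>"

lemma swap_simps [simp]:
  "turn (swap P) \<tau> = map_option other (turn P \<tau>)" "amsg (swap P) = bmsg P" "bmsg (swap P) = amsg P"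
  by (simp_all add: swap_def)

lemma other_eq_iff [simp]: "other p = Alice \<longleftrightarrow> p = Bob" "other p = Bob \<longleftrightarrow> p = Alice"
  by (cases p; simp)+

lemma map_option_other [simp]:
  "map_option other p = Some Alice \<longleftrightarrow> p = Some Bob"
  "map_option other p = Some Bob \<longleftrightarrow> p = Some Alice"
  by (auto elim: other.elims)

lemma trans_swap [simp]: "trans (swap P) Sb Sa n = trans P Sa Sb n"
  by (induction n) (auto simp: Let_def split: option.splits party.splits)

lemma swap_swap [simp]: "swap (swap P) = P"
proof -
  have "other (other p) = p" for p by (cases p) auto
  then have "map_option other \<circ> (map_option other \<circ> turn P) = turn P"
    by (simp add: fun_eq_iff option.map_comp o_def option.map_ident)
  then show ?thesis by (simp add: swap_def)
qed

text \<open>All that the adversary uses about a protocol: a fixed set of possible messages, and no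
  halt at a transcript shared by the two pairs of a conflict.\<close>

definition live ::
  "nat \<Rightarrow> 'x protocol \<Rightarrow> ('a \<Rightarrow> 'x sample) \<Rightarrow> ('b \<Rightarrow> 'x sample) \<Rightarrow> 'x msg set \<Rightarrow>
   'a set \<Rightarrow> ('a \<Rightarrow> strat) \<Rightarrow> 'b set \<Rightarrow> ('b \<Rightarrow> strat) \<Rightarrow> bool" where
  "live k P SA SB Ms A pa B pb \<longleftrightarrow>
     (\<forall>a\<in>A. \<forall>b\<in>B. \<forall>n. let \<tau> = trans P (SA a) (SB b) n in
        (turn P \<tau> = Some Alice \<longrightarrow> amsg P (SA a) \<tau> \<in> Ms) \<and>
        (turn P \<tau> = Some Bob \<longrightarrow> bmsg P (SB b) \<tau> \<in> Ms)) \<and>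
     (\<forall>a\<in>A. \<forall>a'\<in>A. \<forall>b\<in>B. \<forall>b'\<in>B. \<forall>n. conflict k (pa a, pb b) (pa a', pb b') \<longrightarrow>
        trans P (SA a) (SB b) n = trans P (SA a') (SB b') n \<longrightarrow>
        turn P (trans P (SA a) (SB b) n) \<noteq> None)"

lemma live_subset:
  "live k P SA SB Ms A pa B pb \<Longrightarrow> A' \<subseteq> A \<Longrightarrow> B' \<subseteq> B \<Longrightarrow> live k P SA SB Ms A' pa B' pb"
  unfolding live_def by blast

lemma live_descend:
  assumes l: "live k P SA SB Ms A pa B pb" and d: "dense k \<alpha> (Suc t) A pa B pb"
  shows "live k (swap P) SB SA Ms {b\<in>B. picked (pb b) = j} (branch j \<circ> pb) A (branch j \<circ> pa)"
proof -
  have "turn P (trans P (SA a) (SB b) n) \<noteq> None"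
    if "a \<in> A" "a' \<in> A" "b \<in> B" "b' \<in> B" "picked (pb b) = j" "picked (pb b') = j"
      "conflict k (branch j (pb b), branch j (pa a)) (branch j (pb b'), branch j (pa a'))"
      "trans P (SA a) (SB b) n = trans P (SA a') (SB b') n" for a a' b b' n
  proof -
    have "conflict k (pa a', pb b') (pa a, pb b)"
      by (rule conflict_descend[OF _ _ _ _ that(5-7)]) (use dense_mem[OF d] that in blast)+
    then show ?thesis using l that unfolding live_def by metis
  qed
  then show ?thesis
    using l unfolding live_def Let_def by (auto simp del: conflict.simps)
qed

text \<open>Density counts projected inputs, and classes of different messages may overlap after
  projection by \<open>p\<close>; hence a union bound instead of a partition.\<close>

lemma pigeonhole_image:
  assumes M: "finite M" "\<And>a. a \<in> A \<Longrightarrow> m a \<in> M" and A: "A \<noteq> {}"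
  shows "\<exists>\<mu>\<in>M. card (p ` A) \<le> card M * card (p ` {a\<in>A. m a = \<mu>})"
proof (rule ccontr)
  assume "\<not> ?thesis"
  then have less: "card M * card (p ` {a\<in>A. m a = \<mu>}) < card (p ` A)" if "\<mu> \<in> M" for \<mu>
    using that by (simp add: not_le)
  have "M \<noteq> {}" using assms by auto
  have "p ` A = (\<Union>\<mu>\<in>M. p ` {a\<in>A. m a = \<mu>})" using M(2) by auto
  then have "card (p ` A) \<le> (\<Sum>\<mu>\<in>M. card (p ` {a\<in>A. m a = \<mu>}))"
    using card_UN_le[OF M(1)] by metis
  then have "card M * card (p ` A) \<le> (\<Sum>\<mu>\<in>M. card M * card (p ` {a\<in>A. m a = \<mu>}))"
    by (metis mult_le_mono2 sum_distrib_left)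
  also have "\<dots> < (\<Sum>\<mu>\<in>M. card (p ` A))"
    using less M(1) \<open>M \<noteq> {}\<close> by (intro sum_strict_mono) auto
  finally show False by simp
qed

text \<open>
  A message of the branching player divides that player's density by the number of messages, and
  descending one level restores it. The picker cannot afford a message, but becomes the branching
  player after a descent; hence one message costs at most two levels.
\<close>

lemma dense_message:
  fixes SA :: "'a \<Rightarrow> 'x sample" and SB :: "'b \<Rightarrow> 'x sample"
  assumes d: "dense k (5/8) (Suc t) A pa B pb" and k: "k = 8 * q" "0 < q"
    and M: "finite Ms" "card Ms \<le> M" "2 * real M < (4/3) ^ q"
    and l: "live k P SA SB Ms A pa B pb"
    and tr: "\<And>a b. a \<in> A \<Longrightarrow> b \<in> B \<Longrightarrow> trans P (SA a) (SB b) n = \<tau>"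
    and turn: "turn P \<tau> = Some Alice"
  obtains j A' B' \<mu> where "A' \<subseteq> A" "B' \<subseteq> {b\<in>B. picked (pb b) = j}"
    "dense k (5/8) t B' (branch j \<circ> pb) A' (branch j \<circ> pa)"
    "live k (swap P) SB SA Ms B' (branch j \<circ> pb) A' (branch j \<circ> pa)"
    "\<And>a b. a \<in> A' \<Longrightarrow> b \<in> B' \<Longrightarrow> trans P (SA a) (SB b) (Suc n) = \<tau> @ [\<mu>]"
proof -
  have kpos: "0 < k" using k by simp
  note pos = card_strats_pos[OF kpos, of "Suc t"]
  have Ane: "A \<noteq> {}" and Bne: "B \<noteq> {}" using d pos by (auto simp: dense_def)
  then obtain b0 where "b0 \<in> B" by auto
  then have msg: "amsg P (SA a) \<tau> \<in> Ms" if "a \<in> A" for a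
    using l that tr turn unfolding live_def Let_def by metis
  have fin: "finite (pa ` A)"
    using d finite_strats unfolding dense_def by (meson finite_subset)
  obtain \<mu> where \<mu>: "card (pa ` A) \<le> card Ms * card (pa ` {a\<in>A. amsg P (SA a) \<tau> = \<mu>})"
    using pigeonhole_image[where p = pa and m = "\<lambda>a. amsg P (SA a) \<tau>", OF M(1) msg Ane] by blast
  define A' where "A' = {a\<in>A. amsg P (SA a) \<tau> = \<mu>}"
  have "card (pa ` A) \<le> M * card (pa ` A')"
    using \<mu> M(2) unfolding A'_def by (meson le_trans mult_le_mono1)
  then have c: "real (card (pa ` A)) \<le> real M * real (card (pa ` A'))"
    by (metis of_nat_le_iff of_nat_mult)
  have "card (pa ` A) > 0" using Ane fin by (simp add: card_gt_0_iff)
  then have Mpos: "0 < real M" using c by (cases "M = 0") auto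
  have "5/8 * real (card (branchers k (Suc t))) \<le> real M * real (card (pa ` A'))"
    using d c by (simp add: dense_def)
  then have c': "5 / (8 * real M) * real (card (branchers k (Suc t))) \<le> real (card (pa ` A'))"
    using Mpos by (simp add: field_simps)
  have "pa ` A' \<subseteq> pa ` A" by (auto simp: A'_def)
  then have d': "dense k (5 / (8 * real M)) (Suc t) A' pa B pb"
    using d c' unfolding dense_def by (meson order_trans)
  \<comment> \<open>The bound on \<open>M\<close> ensures that density 5/8 divided by
    \<open>M\<close> still exceeds (3/4)^q, as a descent requires.\<close>
  have "(3/4 :: real) ^ q * (4/3) ^ q = 1" by (simp add: power_mult_distrib[symmetric])
  then have "(3/4 :: real) ^ q * (2 * real M) < 1"
    using mult_strict_left_mono[OF M(3), of "(3/4) ^ q"] by simp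
  then have "(3/4 :: real) ^ q * (8 * real M) < 5" by argo
  then have \<alpha>: "(3/4 :: real) ^ q < 5 / (8 * real M)" using Mpos by (subst pos_less_divide_eq) auto
  obtain j where j: "dense k (5/8) t {b\<in>B. picked (pb b) = j} (branch j \<circ> pb) A' (branch j \<circ> pa)"
    using dense_descend[OF d' k \<alpha>] .
  have l': "live k P SA SB Ms A' pa B pb" using l by (rule live_subset) (auto simp: A'_def)
  show ?thesis
  proof (rule that[OF _ subset_refl j live_descend[OF l' d']])
    show "A' \<subseteq> A" by (auto simp: A'_def)
    show "trans P (SA a) (SB b) (Suc n) = \<tau> @ [\<mu>]"
      if "a \<in> A'" "b \<in> {b\<in>B. picked (pb b) = j}" for a b
      using that tr turn by (simp add: A'_def)
  qed
qed

text \<open>Induction on the number \<open>r\<close> of messages still to be forced. The conflict is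
  kept in the conclusion because it shows that the players do not both own the meeting point, so the
  long run is on a realizable input.\<close>

lemma long_transcript:
  fixes SA SB :: "'a \<Rightarrow> 'x sample"
  assumes "dense k (5/8) (2 * r) A pa B pb" and k: "k = 8 * q" "0 < q"
    and M: "finite Ms" "card Ms \<le> M" "2 * real M < (4/3) ^ q" "1 \<le> M"
    and "live k P SA SB Ms A pa B pb"
    and "\<And>a b. a \<in> A \<Longrightarrow> b \<in> B \<Longrightarrow> trans P (SA a) (SB b) n = \<tau>" "length \<tau> = n"
  shows "\<exists>a\<in>A. \<exists>b\<in>B. \<exists>a'\<in>A. \<exists>b'\<in>B. conflict k (pa a, pb b) (pa a', pb b') \<and>
    length (trans P (SA a) (SB b) (n + r)) = n + r"
proof -
  \<comment> \<open>Since (4/3)^q > 2, density 5/8 always allows a descent without a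
    message.\<close>
  have "(3/4 :: real) ^ q * (4/3) ^ q = 1" by (simp add: power_mult_distrib[symmetric])
  moreover have "2 < (4/3 :: real) ^ q" using M by simp
  ultimately have q: "(3/4 :: real) ^ q < 5/8"
    using mult_strict_left_mono[of 2 "(4/3 :: real) ^ q" "(3/4) ^ q"] by simp
  show ?thesis
    using assms(1,8-)
  proof (induction r arbitrary: A B pa pb n \<tau>)
    case 0
    then show ?case using dense_conflict[OF _ k q] by fastforce
  next
    case (Suc r)
    have d: "dense k (5/8) (Suc (Suc (2 * r))) A pa B pb" using Suc.prems(1) by simp
    note l = Suc.prems(2) and tr = Suc.prems(3) and len = Suc.prems(4)
    \<comment> \<open>The common end of both cases: one message later and two levels down, the
      induction hypothesis applies. Lifting its conflict twice restores the order of the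
      pairs.\<close>
    have reach: ?case
      if A': "A' \<subseteq> A" and B': "B' \<subseteq> B"
        and A'j: "\<And>a. a \<in> A' \<Longrightarrow> picked (branch j (pa a)) = i"
        and B'j: "\<And>b. b \<in> B' \<Longrightarrow> picked (pb b) = j"
        and d': "dense k (5/8) (2 * r) A' (branch i \<circ> (branch j \<circ> pa)) B' (branch i \<circ> (branch j \<circ> pb))"
        and l': "live k P SA SB Ms A' (branch i \<circ> (branch j \<circ> pa)) B' (branch i \<circ> (branch j \<circ> pb))"
        and tr': "\<And>a b. a \<in> A' \<Longrightarrow> b \<in> B' \<Longrightarrow> trans P (SA a) (SB b) (Suc n) = \<tau> @ [\<mu>]"
        and dj: "(branch j \<circ> pb) ` B' \<subseteq> branchers k (Suc (2 * r))"
          "(branch j \<circ> pa) ` A' \<subseteq> pickers k (Suc (2 * r))"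
      for A' B' i j \<mu>
    proof -
      obtain a b a' b' where *: "a \<in> A'" "b \<in> B'" "a' \<in> A'" "b' \<in> B'"
        and c: "conflict k (branch i (branch j (pa a)), branch i (branch j (pb b)))
          (branch i (branch j (pa a')), branch i (branch j (pb b')))"
        and ln: "length (trans P (SA a) (SB b) (Suc n + r)) = Suc n + r"
        using Suc.IH[OF d' l' tr'] len by auto
      have "conflict k (branch j (pb b'), branch j (pa a')) (branch j (pb b), branch j (pa a))"
        by (rule conflict_descend[OF _ _ _ _ _ _ c, where t = "2 * r"]) (use * A'j dj in auto)
      then have "conflict k (pa a, pb b) (pa a', pb b')"
        by (rule conflict_descend[rotated -1, where t = "Suc (2 * r)"])
          (use * B'j dense_mem[OF d] subsetD[OF A'] subsetD[OF B'] in blast)+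
      then show ?thesis using * A' B' ln
        by (intro bexI[of _ a] bexI[of _ b] bexI[of _ a'] bexI[of _ b']) auto
    qed
    show ?case
    proof (cases "turn P \<tau>")
      case None
      \<comment> \<open>A halt is impossible: the rectangle is still dense enough to contain a
        conflict, and all its runs share this transcript.\<close>
      obtain a a' b b' where "a \<in> A" "a' \<in> A" "b \<in> B" "b' \<in> B"
        "conflict k (pa a, pb b) (pa a', pb b')"
        using dense_conflict[OF d k q] by blast
      then show ?thesis using l tr None unfolding live_def by metis
    next
      case (Some p)
      show ?thesis
      proof (cases p)
        case Alice
        with Some have turn: "turn P \<tau> = Some Alice" by simp
        show ?thesis
        proof (rule dense_message[OF d k M(1-3) l tr turn])
          fix j A' B' \<mu>
          assume 1: "A' \<subseteq> A" "B' \<subseteq> {b\<in>B. picked (pb b) = j}"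
              "dense k (5/8) (Suc (2 * r)) B' (branch j \<circ> pb) A' (branch j \<circ> pa)"
              "live k (swap P) SB SA Ms B' (branch j \<circ> pb) A' (branch j \<circ> pa)"
              "\<And>a b. a \<in> A' \<Longrightarrow> b \<in> B' \<Longrightarrow> trans P (SA a) (SB b) (Suc n) = \<tau> @ [\<mu>]"
          \<comment> \<open>The message has exchanged the roles; a second descent, without a
            message, restores them.\<close>
          obtain i where 2: "dense k (5/8) (2 * r) {a\<in>A'. picked ((branch j \<circ> pa) a) = i}
              (branch i \<circ> (branch j \<circ> pa)) B' (branch i \<circ> (branch j \<circ> pb))"
            using dense_descend[OF 1(3) k q] .
          show ?thesis
            by (rule reach[OF _ _ _ _ 2 live_descend[OF 1(4,3), unfolded swap_swap]])
              (use 1(1,2,5) dense_mem[OF 1(3)] in \<open>auto simp del: trans.simps branchers.simps pickers.simps\<close>)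
        qed
      next
        case Bob
        \<comment> \<open>Bob is the picker, so a descent comes first to make him the branching
          player before he speaks.\<close>
        obtain j where 1: "dense k (5/8) (Suc (2 * r)) {b\<in>B. picked (pb b) = j}
            (branch j \<circ> pb) A (branch j \<circ> pa)"
          using dense_descend[OF d k q] .
        have tr': "trans (swap P) (SB b) (SA a) n = \<tau>" if "b \<in> {b\<in>B. picked (pb b) = j}" "a \<in> A" for a b
          using that tr by simp
        have turn: "turn (swap P) \<tau> = Some Alice" using Some Bob by simp
        show ?thesis
        proof (rule dense_message[OF 1 k M(1-3) live_descend[OF l d] tr' turn])
          fix i B' A' \<mu>
          assume 2: "B' \<subseteq> {b\<in>B. picked (pb b) = j}" "A' \<subseteq> {a\<in>A. picked ((branch j \<circ> pa) a) = i}"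
              "dense k (5/8) (2 * r) A' (branch i \<circ> (branch j \<circ> pa)) B' (branch i \<circ> (branch j \<circ> pb))"
              "live k (swap (swap P)) SA SB Ms A' (branch i \<circ> (branch j \<circ> pa)) B' (branch i \<circ> (branch j \<circ> pb))"
              "\<And>b a. b \<in> B' \<Longrightarrow> a \<in> A' \<Longrightarrow> trans (swap P) (SB b) (SA a) (Suc n) = \<tau> @ [\<mu>]"
          show ?thesis
            by (rule reach[OF _ _ _ _ 2(3) 2(4)[unfolded swap_swap]])
              (use 2 dense_mem[OF 1] in \<open>auto simp del: trans.simps branchers.simps pickers.simps\<close>)
        qed
      qed
    qed
  qed
qed

section \<open>The dependence on the error\<close>

fun embed :: "nat \<Rightarrow> real \<times> real \<Rightarrow> real list" where
  "embed d (x, y) = x # y # replicate (d - 2) 0"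

definition labelled :: "nat \<Rightarrow> nat \<Rightarrow> bool \<Rightarrow> strat \<Rightarrow> real list sample" where
  "labelled d k l u = map (\<lambda>p. (embed d p, l)) (points k u)"

lemma in_dom_labelled: "2 \<le> d \<Longrightarrow> in_dom d (labelled d k l u)"
  by (auto simp: in_dom_def labelled_def)

lemma embed_halfspace:
  assumes "2 \<le> d"
  shows "\<exists>h\<in>halfspaces d. \<forall>x y. h (embed d (x, y)) = (y - s * x \<ge> b)"
proof -
  obtain n where d: "d = Suc (Suc n)" using assms by (metis Suc_le_D numeral_2_eq_2 Suc_le_mono)
  let ?w = "(- s) # 1 # replicate n 0"
  have "(\<Sum>i<d. ?w ! i * embed d (x, y) ! i) = y - s * x" for x y
    by (simp add: d sum.lessThan_Suc_shift del: sum.lessThan_Suc)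
  moreover have "(\<lambda>x. (\<Sum>i<d. ?w ! i * x ! i) \<ge> b) \<in> halfspaces d"
    unfolding halfspaces_def by (auto simp: d intro!: exI[of _ ?w])
  ultimately show ?thesis by (intro bexI) auto
qed

lemma realizableI:
  assumes "h \<in> H" "\<And>x y. (x, y) \<in> set S \<Longrightarrow> h x = y"
  shows "realizable H S"
proof -
  have "filter (\<lambda>(x, y). h x \<noteq> y) S = []" using assms(2) by (auto simp: filter_empty_conv)
  then show ?thesis using assms(1) unfolding realizable_def emp_loss_def by (intro bexI) auto
qed

lemma consistent_if_small_loss:
  assumes "emp_loss S h \<le> eps" "eps * real (length S) < 1" "(x, y) \<in> set S"
  shows "h x = y"
proof (rule ccontr)
  assume "h x \<noteq> y"
  then have "(x, y) \<in> set (filter (\<lambda>(x, y). h x \<noteq> y) S)" using assms(3) by auto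
  then have "1 \<le> length (filter (\<lambda>(x, y). h x \<noteq> y) S)" "0 < length S"
    by (metis One_nat_def Suc_leI length_pos_if_in_set) (metis assms(3) length_pos_if_in_set)
  then have "1 \<le> emp_loss S h * real (length S)" by (simp add: emp_loss_def)
  also have "\<dots> \<le> eps * real (length S)" using assms(1) by (simp add: mult_right_mono)
  finally show False using assms(2) by simp
qed

lemma realizable_pair:
  assumes "2 \<le> d" "0 < k" "u \<in> branchers k t" "v \<in> pickers k t"
    and bits: "\<not> (leaf_bit u v \<and> leaf_bit v u)"
  shows "realizable (halfspaces d) (labelled d k True u @ labelled d k False v)"
proof -
  obtain s c where
    above: "\<And>x y. (x, y)\<in>set (points k u) \<Longrightarrow> y > s * x + c \<or> leaf_bit u v \<and> y = s * x + c" and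
    below: "\<And>x y. (x, y)\<in>set (points k v) \<Longrightarrow> y < s * x + c \<or> leaf_bit v u \<and> y = s * x + c"
    using separating_line[OF assms(2-4)] by blast
  \<comment> \<open>Half-spaces are closed on the positive side, so \<open>c\<close> serves as
    threshold unless Bob owns the point on the line. In that case the threshold is raised to the
    lowest positive point; \<open>c + 1\<close> covers the absence of positive points.\<close>
  have "\<exists>b. (\<forall>(x, y)\<in>set (points k u). y - s * x \<ge> b) \<and> (\<forall>(x, y)\<in>set (points k v). y - s * x < b)"
  proof (cases "leaf_bit v u")
    case False
    then show ?thesis using above below by (intro exI[of _ c]) fastforce
  next
    case True
    then have u: "\<not> leaf_bit u v" using bits by simp
    define Z where "Z = insert (c + 1) ((\<lambda>(x, y). y - s * x) ` set (points k u))"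
    have Z: "finite Z" "Z \<noteq> {}" by (auto simp: Z_def)
    have "c < Min Z"
      using Z above u by (force simp: Z_def)
    moreover have "\<forall>(x, y)\<in>set (points k u). y - s * x \<ge> Min Z"
      using Z(1) by (force simp: Z_def intro!: Min_le)
    ultimately show ?thesis using below by (intro exI[of _ "Min Z"]) fastforce
  qed
  then obtain b where
    "\<And>x y. (x, y)\<in>set (points k u) \<Longrightarrow> y - s * x \<ge> b"
    "\<And>x y. (x, y)\<in>set (points k v) \<Longrightarrow> y - s * x < b" by blast
  moreover obtain h where "h \<in> halfspaces d" "\<And>x y. h (embed d (x, y)) = (y - s * x \<ge> b)"
    using embed_halfspace[OF assms(1)] by blast
  ultimately show ?thesis
    by (intro realizableI[of h]) (fastforce simp: labelled_def simp del: embed.simps)+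
qed

lemma trans_stable: "halts_at P Sa Sb n \<Longrightarrow> n \<le> m \<Longrightarrow> trans P Sa Sb m = trans P Sa Sb n"
  by (induction m) (auto simp: halts_at_def le_Suc_eq)

lemma trans_halt_unique:
  "halts_at P Sa Sb n \<Longrightarrow> halts_at P Sa Sb m \<Longrightarrow> trans P Sa Sb n = trans P Sa Sb m"
  by (metis nle_le trans_stable)

lemma length_trans_mono: "n \<le> m \<Longrightarrow> length (trans P Sa Sb n) \<le> length (trans P Sa Sb m)"
  by (induction m) (auto simp: Let_def le_Suc_eq split: option.splits party.splits)

lemma length_trans_halt:
  assumes "halts_at P Sa Sb n" shows "length (trans P Sa Sb m) \<le> length (trans P Sa Sb n)"
proof (cases "m \<le> n")
  case False
  then show ?thesis using trans_stable[OF assms, of m] by simp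
qed (rule length_trans_mono)

text \<open>The sample has fewer than 1/eps points, so the output must be consistent with it; this
  makes every conflict a reason not to halt.\<close>

lemma eps_bound:
  assumes "2 \<le> d" and P: "learns_realizable d (halfspaces d) eps P"
    and k: "k = 8 * q" "0 < q" and eps: "0 < eps" "eps * (2 * real k ^ (2 * r)) < 1"
    and q: "2 * (2 * real k ^ (2 * r) + 2) < (4/3) ^ q"
  shows "\<exists>Sa Sb n. in_dom d Sa \<and> in_dom d Sb \<and> realizable (halfspaces d) (Sa @ Sb) \<and>
    halts_at P Sa Sb n \<and> r \<le> length (trans P Sa Sb n)"
proof -
  define t where "t = 2 * r"
  have kpos: "0 < k" using k by simp
  let ?A = "branchers k t" and ?B = "pickers k t"
  let ?SA = "labelled d k True" and ?SB = "labelled d k False"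
  define Ms where "Ms = (\<lambda>p. Ex (embed d p, True)) ` grid k t \<union>
    (\<lambda>p. Ex (embed d p, False)) ` grid k t \<union> range Bit"
  have dom: "in_dom d (?SA u)" "in_dom d (?SB u)" for u using in_dom_labelled[OF assms(1)] by auto
  have fin: "finite Ms" using finite_grid by (simp add: Ms_def)
  have "card Ms \<le> (card (grid k t) + card (grid k t)) + 2"
  proof -
    have "card (range Bit) \<le> 2" using card_image_le[of "UNIV :: bool set" Bit] by simp
    then show ?thesis unfolding Ms_def
      by (intro order_trans[OF card_Un_le] add_mono order_trans[OF card_Un_le] card_image_le finite_grid)
  qed
  then have cM: "card Ms \<le> 2 * k ^ t + 2" using card_grid[of k t] by linarith
  have small: "eps * real (length (?SA u @ ?SB v)) < 1" if "u \<in> ?A" "v \<in> ?B" for u v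
  proof -
    have "length (points k u) \<le> k ^ t" "length (points k v) \<le> k ^ t"
      using length_points[OF kpos] that by auto
    then have "length (?SA u @ ?SB v) \<le> 2 * k ^ t" by (simp add: labelled_def)
    then have "real (length (?SA u @ ?SB v)) \<le> 2 * real k ^ t"
      by (metis of_nat_le_iff of_nat_mult of_nat_numeral of_nat_power)
    then have "eps * real (length (?SA u @ ?SB v)) \<le> eps * (2 * real k ^ t)"
      using eps(1) by (intro mult_left_mono) auto
    then show ?thesis using eps(2) by (simp add: t_def)
  qed
  have msg: "amsg P (?SA u) (trans P (?SA u) (?SB v) n) \<in> Ms"
    if "turn P (trans P (?SA u) (?SB v) n) = Some Alice" "u \<in> ?A" for u v n
  proof -
    have "msg_ok (?SA u) (amsg P (?SA u) (trans P (?SA u) (?SB v) n))"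
      using P dom that(1) unfolding learns_realizable_def valid_run_def Let_def by blast
    then show ?thesis using points_grid[of u k t] that(2)
      by (cases "amsg P (?SA u) (trans P (?SA u) (?SB v) n)")
        (auto simp: Ms_def labelled_def simp del: embed.simps)
  qed
  have msg': "bmsg P (?SB v) (trans P (?SA u) (?SB v) n) \<in> Ms"
    if "turn P (trans P (?SA u) (?SB v) n) = Some Bob" "v \<in> ?B" for u v n
  proof -
    have "msg_ok (?SB v) (bmsg P (?SB v) (trans P (?SA u) (?SB v) n))"
      using P dom that(1) unfolding learns_realizable_def valid_run_def Let_def by blast
    then show ?thesis using points_grid[of v k t] that(2)
      by (cases "bmsg P (?SB v) (trans P (?SA u) (?SB v) n)")
        (auto simp: Ms_def labelled_def simp del: embed.simps)
  qed
  have correct: "out P (trans P (?SA u) (?SB v) n) x = y"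
    if "u \<in> ?A" "v \<in> ?B" "\<not> (leaf_bit u v \<and> leaf_bit v u)"
      "turn P (trans P (?SA u) (?SB v) n) = None" "(x, y) \<in> set (?SA u @ ?SB v)" for u v n x y
  proof -
    have "realizable (halfspaces d) (?SA u @ ?SB v)"
      using realizable_pair[OF assms(1) kpos that(1-3)] .
    then obtain m where "halts_at P (?SA u) (?SB v) m"
      "emp_loss (?SA u @ ?SB v) (out P (trans P (?SA u) (?SB v) m)) \<le> eps"
      using P dom unfolding learns_realizable_def by blast
    moreover have "halts_at P (?SA u) (?SB v) n" using that(4) by (simp add: halts_at_def)
    ultimately have "emp_loss (?SA u @ ?SB v) (out P (trans P (?SA u) (?SB v) n)) \<le> eps"
      by (metis trans_halt_unique)
    then show ?thesis by (rule consistent_if_small_loss[OF _ small[OF that(1,2)] that(5)])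
  qed
  \<comment> \<open>Equal final transcripts give one hypothesis, which would have to label the
    meeting point positive for one pair and negative for the other.\<close>
  have no_halt: "turn P (trans P (?SA u) (?SB v) n) \<noteq> None"
    if u: "u \<in> ?A" "u' \<in> ?A" and v: "v \<in> ?B" "v' \<in> ?B"
      and c: "conflict k (u, v) (u', v')"
      and e: "trans P (?SA u) (?SB v) n = trans P (?SA u') (?SB v') n" for u u' v v' n
  proof
    assume N: "turn P (trans P (?SA u) (?SB v) n) = None"
    let ?x = "embed d (meet k u v)"
    have "meet k u v \<in> set (points k u)" using meet_in_points(1)[OF u(1) v(1)] c by simp
    then have "out P (trans P (?SA u) (?SB v) n) ?x = True"
      using c by (intro correct[OF u(1) v(1) _ N]) (auto simp: labelled_def)
    moreover have "meet k u v \<in> set (points k v')" using meet_in_points(2)[OF u(2) v(2)] c by simp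
    then have "out P (trans P (?SA u') (?SB v') n) ?x = False"
      using c N e by (intro correct[OF u(2) v(2)]) (auto simp: labelled_def)
    ultimately show False using e by simp
  qed
  have live: "live k P ?SA ?SB Ms ?A (\<lambda>u. u) ?B (\<lambda>v. v)"
    unfolding live_def Let_def using msg msg' no_halt by blast
  \<comment> \<open>The adversary starts with all inputs, at density 1.\<close>
  have dense: "dense k (5/8) (2 * r) ?A (\<lambda>u. u) ?B (\<lambda>v. v)"
    by (simp add: dense_def t_def)
  have "2 * real (2 * k ^ t + 2) < (4/3) ^ q" using q by (simp add: t_def)
  from long_transcript[OF dense k fin cM this _ live, of 0 "[]"]
  obtain u v u' v' where u: "u \<in> ?A" "v \<in> ?B" "conflict k (u, v) (u', v')"
    and len: "length (trans P (?SA u) (?SB v) (0 + r)) = 0 + r" by auto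
  have r: "realizable (halfspaces d) (?SA u @ ?SB v)"
    using realizable_pair[OF assms(1) kpos u(1,2)] u(3) by auto
  then obtain n where n: "halts_at P (?SA u) (?SB v) n"
    using P dom unfolding learns_realizable_def by blast
  then have "r \<le> length (trans P (?SA u) (?SB v) n)"
    using length_trans_halt[OF n, of r] len by simp
  then show ?thesis using dom r n by blast
qed

section \<open>The dependence on the dimension\<close>

text \<open>A Hamming ball of radius \<open>m\<close>: weighting each set by (1/2)^distance gives
  total weight (1 + 1/2)^d, and each member of the ball weighs at least (1/2)^m.\<close>

lemma card_near_subsets:
  assumes "h \<subseteq> {..<d}"
  shows "real (card {Y \<in> Pow {..<d}. card {i\<in>{..<d}. (i \<in> h) \<noteq> (i \<in> Y)} \<le> m}) \<le> 2 ^ m * (3/2) ^ d"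
proof -
  let ?D = "\<lambda>Y. {i\<in>{..<d}. (i \<in> h) \<noteq> (i \<in> Y)}"
  let ?N = "{Y \<in> Pow {..<d}. card (?D Y) \<le> m}"
  \<comment> \<open>\<open>f\<close> is the factor of a coordinate inside \<open>Y\<close>,
    \<open>g\<close> of one outside; they sum to 3/2 everywhere.\<close>
  define f where "f = (\<lambda>i. if i \<in> h then 1 else 1/2 :: real)"
  define g where "g = (\<lambda>i. if i \<in> h then 1/2 else 1 :: real)"
  have "(\<Prod>i\<in>Y. f i) * (\<Prod>i\<in>{..<d} - Y. g i) = (1/2) ^ card (?D Y)" if Y: "Y \<subseteq> {..<d}" for Y
  proof -
    let ?e = "\<lambda>i. if (i \<in> h) \<noteq> (i \<in> Y) then 1/2 else 1 :: real"
    have "(\<Prod>i\<in>Y. f i) = (\<Prod>i\<in>Y. ?e i)" "(\<Prod>i\<in>{..<d} - Y. g i) = (\<Prod>i\<in>{..<d} - Y. ?e i)"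
      by (auto simp: f_def g_def intro!: prod.cong)
    then have "(\<Prod>i\<in>Y. f i) * (\<Prod>i\<in>{..<d} - Y. g i) = (\<Prod>i<d. ?e i)"
      using prod.subset_diff[OF Y, of ?e] by simp
    also have "\<dots> = (1/2) ^ card (?D Y)" by (simp add: prod.If_cases Int_def)
    finally show ?thesis .
  qed
  then have "(\<Sum>Y\<in>Pow {..<d}. (1/2) ^ card (?D Y)) =
      (\<Sum>Y\<in>Pow {..<d}. (\<Prod>i\<in>Y. f i) * (\<Prod>i\<in>{..<d} - Y. g i))"
    by (intro sum.cong) auto
  also have "\<dots> = (\<Prod>i<d. f i + g i)" by (rule prod_add[symmetric]) simp
  also have "\<dots> = (\<Prod>i<d. 3/2)" by (intro prod.cong) (auto simp: f_def g_def)
  finally have total: "(\<Sum>Y\<in>Pow {..<d}. (1/2) ^ card (?D Y)) = (3/2 :: real) ^ d" by simp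
  have "real (card ?N) * (1/2) ^ m = (\<Sum>Y\<in>?N. (1/2) ^ m)" by simp
  also have "\<dots> \<le> (\<Sum>Y\<in>?N. (1/2) ^ card (?D Y))"
    by (intro sum_mono power_decreasing) auto
  also have "\<dots> \<le> (\<Sum>Y\<in>Pow {..<d}. (1/2) ^ card (?D Y))"
    by (intro sum_mono2) auto
  finally have "real (card ?N) * (1/2) ^ m \<le> (3/2) ^ d" using total by simp
  then have "real (card ?N) * (1/2) ^ m * 2 ^ m \<le> (3/2) ^ d * 2 ^ m"
    by (rule mult_right_mono) simp
  moreover have "(1/2 :: real) ^ m * 2 ^ m = 1" by (simp add: power_mult_distrib[symmetric])
  ultimately show ?thesis by (simp only: mult.assoc mult_1_right mult.commute[of "(3/2) ^ d"])
qed

text \<open>Words of length at most \<open>n\<close> become words of length \<open>n\<close> when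
  padded with one additional letter.\<close>

lemma sum_powers_le: "(\<Sum>i\<le>n. N ^ i) \<le> (N + 1 :: nat) ^ n"
proof (induction n)
  case (Suc n)
  have "N ^ Suc n \<le> N * (N + 1) ^ n" by (simp add: power_mono)
  then have "(\<Sum>i\<le>n. N ^ i) + N ^ Suc n \<le> (N + 1) ^ n + N * (N + 1) ^ n"
    using Suc.IH by (rule add_mono[rotated])
  then show ?case by simp
qed simp

definition unit :: "nat \<Rightarrow> nat \<Rightarrow> real list" where
  "unit d i = (replicate d 0)[i := 1]"

definition cube_sample :: "nat \<Rightarrow> nat set \<Rightarrow> real list sample" where
  "cube_sample d Y = map (\<lambda>i. (unit d i, i \<in> Y)) [0..<d]"

lemma realizable_cube_sample: "realizable (halfspaces d) (cube_sample d Y)"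
proof -
  let ?w = "map (\<lambda>i. if i \<in> Y then 1 else - 1 :: real) [0..<d]"
  let ?h = "\<lambda>x. (\<Sum>i<d. ?w ! i * x ! i) \<ge> 0"
  have "?h \<in> halfspaces d" unfolding halfspaces_def by (auto intro!: exI[of _ ?w])
  moreover have "?h (unit d j) = (j \<in> Y)" if "j < d" for j
  proof -
    have "(\<Sum>i<d. ?w ! i * unit d j ! i) = (\<Sum>i<d. if i = j then ?w ! j else 0)"
      using that by (intro sum.cong) (auto simp: unit_def nth_list_update)
    also have "\<dots> = ?w ! j" using that by simp
    finally show ?thesis using that by simp
  qed
  ultimately show ?thesis by (intro realizableI[of ?h]) (auto simp: cube_sample_def)
qed

lemma in_dom_cube_sample: "in_dom d (cube_sample d Y)" "in_dom d []"
  by (auto simp: in_dom_def cube_sample_def unit_def)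

text \<open>The loss is a normalized Hamming distance; the product form also covers dimension
  0.\<close>

lemma emp_loss_cube_sample:
  "emp_loss (cube_sample d Y) h * real d =
    real (card {i\<in>{..<d}. (i \<in> {i\<in>{..<d}. h (unit d i)}) \<noteq> (i \<in> Y)})"
proof -
  have "length (filter (\<lambda>(x, y). h x \<noteq> y) (cube_sample d Y)) =
      length (filter (\<lambda>i. h (unit d i) \<noteq> (i \<in> Y)) [0..<d])"
    by (simp add: cube_sample_def filter_map o_def)
  also have "\<dots> = card ({i. h (unit d i) \<noteq> (i \<in> Y)} \<inter> set [0..<d])"
    by (rule distinct_length_filter) simp
  also have "{i. h (unit d i) \<noteq> (i \<in> Y)} \<inter> set [0..<d] =
      {i\<in>{..<d}. (i \<in> {i\<in>{..<d}. h (unit d i)}) \<noteq> (i \<in> Y)}" by auto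
  finally show ?thesis by (cases "d = 0") (simp_all add: emp_loss_def cube_sample_def)
qed

lemma trans_msg_ok:
  "valid_run P Sa Sb \<Longrightarrow> m \<in> set (trans P Sa Sb n) \<Longrightarrow> msg_ok (Sa @ Sb) m"
proof (induction n)
  case (Suc n)
  have sub: "msg_ok Sa m \<Longrightarrow> msg_ok (Sa @ Sb) m" "msg_ok Sb m \<Longrightarrow> msg_ok (Sa @ Sb) m" for m
    by (cases m; simp)+
  let ?t = "trans P Sa Sb n"
  have "turn P ?t = Some Alice \<Longrightarrow> msg_ok Sa (amsg P Sa ?t)"
    "turn P ?t = Some Bob \<Longrightarrow> msg_ok Sb (bmsg P Sb ?t)"
    using Suc.prems(1) unfolding valid_run_def Let_def by blast+
  then show ?case using Suc sub by (auto simp: Let_def split: option.splits party.splits)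
qed simp

text \<open>Covering argument with an empty sample for Bob: at most (2d+3)^T transcripts, each close
  to at most 2^(d/3) (3/2)^d labellings, must serve all 2^d. Logarithms give the constant.\<close>

lemma dim_bound:
  assumes P: "learns_realizable d (halfspaces d) eps P" and eps: "eps \<le> 1/3"
  shows "\<exists>Sa Sb n. in_dom d Sa \<and> in_dom d Sb \<and> realizable (halfspaces d) (Sa @ Sb) \<and>
    halts_at P Sa Sb n \<and>
    real d * (2/3 * ln 2 - ln (3/2)) \<le> real (length (trans P Sa Sb n)) * ln (2 * real d + 3)"
proof -
  let ?I = "Pow {..<d}"
  let ?S = "cube_sample d"
  have valid: "valid_run P (?S Y) []" for Y
    using P in_dom_cube_sample unfolding learns_realizable_def by blast
  have "\<forall>Y. \<exists>n. halts_at P (?S Y) [] n \<and> emp_loss (?S Y) (out P (trans P (?S Y) [] n)) \<le> eps"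
    using P in_dom_cube_sample realizable_cube_sample unfolding learns_realizable_def
    by (metis append_Nil2)
  then obtain N where N: "\<And>Y. halts_at P (?S Y) [] (N Y)"
    "\<And>Y. emp_loss (?S Y) (out P (trans P (?S Y) [] (N Y))) \<le> eps" by metis
  define \<tau> where "\<tau> = (\<lambda>Y. trans P (?S Y) [] (N Y))"
  define T where "T = Max ((\<lambda>Y. length (\<tau> Y)) ` ?I)"
  define Ms where "Ms = Ex ` (unit d ` {..<d} \<times> UNIV) \<union> range Bit"
  define Ts where "Ts = {xs. set xs \<subseteq> Ms \<and> length xs \<le> T}"
  define h where "h = (\<lambda>\<sigma>. {i\<in>{..<d}. out P \<sigma> (unit d i)})"
  \<comment> \<open>A labelling \<open>Y0\<close> with the longest transcript supplies the input for
    the conclusion.\<close>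
  have "T \<in> (\<lambda>Y. length (\<tau> Y)) ` ?I" unfolding T_def by (rule Max_in) auto
  then obtain Y0 where Y0: "T = length (\<tau> Y0)" by auto
  have finM: "finite Ms" by (simp add: Ms_def)
  have "card Ms \<le> d * 2 + 2"
  proof -
    have "card (range Bit) \<le> 2" using card_image_le[of "UNIV :: bool set" Bit] by simp
    moreover have "card (Ex ` (unit d ` {..<d} \<times> (UNIV :: bool set))) \<le> d * 2"
    proof -
      have "card (unit d ` {..<d}) \<le> d" using card_image_le[of "{..<d}" "unit d"] by simp
      then have "card (unit d ` {..<d} \<times> (UNIV :: bool set)) \<le> d * 2"
        by (simp add: card_cartesian_product)
      then show ?thesis by (intro order_trans[OF card_image_le]) auto
    qed
    ultimately show ?thesis unfolding Ms_def by (intro order_trans[OF card_Un_le] add_mono)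
  qed
  then have "card Ms + 1 \<le> 2 * d + 3" by simp
  then have "card Ts \<le> (2 * d + 3) ^ T"
    unfolding Ts_def card_lists_length_le[OF finM]
    by (intro order_trans[OF sum_powers_le] power_mono) auto
  then have "real (card Ts) \<le> real ((2 * d + 3) ^ T)" by (simp only: of_nat_le_iff)
  then have cT: "real (card Ts) \<le> (2 * real d + 3) ^ T" by simp
  have finT: "finite Ts" unfolding Ts_def by (rule finite_lists_length_le[OF finM])
  have mem: "\<tau> Y \<in> Ts" if "Y \<in> ?I" for Y
  proof -
    have "m \<in> Ms" if "m \<in> set (\<tau> Y)" for m
      using trans_msg_ok[OF valid that[unfolded \<tau>_def]]
      by (cases m) (auto simp: Ms_def cube_sample_def)
    moreover have "length (\<tau> Y) \<le> T" unfolding T_def using that by (intro Max_ge) auto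
    ultimately show ?thesis by (auto simp: Ts_def)
  qed
  have near: "card {i\<in>{..<d}. (i \<in> h (\<tau> Y)) \<noteq> (i \<in> Y)} \<le> d div 3" for Y
  proof -
    have "real (card {i\<in>{..<d}. (i \<in> h (\<tau> Y)) \<noteq> (i \<in> Y)}) \<le> 1/3 * real d"
      unfolding h_def emp_loss_cube_sample[symmetric] using N(2)[of Y] eps
      by (intro mult_right_mono) (auto simp: \<tau>_def)
    then show ?thesis by linarith
  qed
  let ?B = "\<lambda>\<sigma>. {Y \<in> ?I. card {i\<in>{..<d}. (i \<in> h \<sigma>) \<noteq> (i \<in> Y)} \<le> d div 3}"
  have "?I \<subseteq> (\<Union>\<sigma>\<in>Ts. ?B \<sigma>)" using mem near by blast
  then have "card ?I \<le> card (\<Union>\<sigma>\<in>Ts. ?B \<sigma>)" by (intro card_mono) (auto simp: finT)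
  also have "\<dots> \<le> (\<Sum>\<sigma>\<in>Ts. card (?B \<sigma>))" by (rule card_UN_le[OF finT])
  finally have "real (card ?I) \<le> (\<Sum>\<sigma>\<in>Ts. real (card (?B \<sigma>)))"
    by (simp only: of_nat_sum[symmetric] of_nat_le_iff)
  also have "\<dots> \<le> (\<Sum>\<sigma>\<in>Ts. 2 ^ (d div 3) * (3/2) ^ d)"
  proof (rule sum_mono)
    fix \<sigma>
    have "h \<sigma> \<subseteq> {..<d}" by (auto simp: h_def)
    then show "real (card (?B \<sigma>)) \<le> 2 ^ (d div 3) * (3/2) ^ d" by (rule card_near_subsets)
  qed
  also have "\<dots> = real (card Ts) * (2 ^ (d div 3) * (3/2) ^ d)" by simp
  also have "\<dots> \<le> (2 * real d + 3) ^ T * (2 ^ (d div 3) * (3/2) ^ d)"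
    using cT by (intro mult_right_mono) auto
  finally have "2 ^ d \<le> (2 * real d + 3) ^ T * (2 ^ (d div 3) * (3/2) ^ d)" by (simp add: card_Pow)
  then have "ln (2 ^ d) \<le> ln ((2 * real d + 3) ^ T * (2 ^ (d div 3) * (3/2) ^ d))"
    by (subst ln_le_cancel_iff) auto
  then have "real d * ln 2 \<le> real T * ln (2 * real d + 3) + (real (d div 3) * ln 2 + real d * ln (3/2))"
    by (simp add: ln_mult ln_realpow)
  moreover have "real (d div 3) * ln 2 \<le> real d / 3 * ln 2"
  proof (rule mult_right_mono)
    show "real (d div 3) \<le> real d / 3" by linarith
  qed simp
  ultimately have "real d * (2/3 * ln 2 - ln (3/2)) \<le> real T * ln (2 * real d + 3)"
    by (simp only: right_diff_distrib)
  then show ?thesis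
    using in_dom_cube_sample realizable_cube_sample[of d Y0] N(1)[of Y0] Y0
    by (intro exI[of _ "?S Y0"] exI[of _ "[]"] exI[of _ "N Y0"]) (auto simp: \<tau>_def)
qed

section \<open>Combining the bounds\<close>

text \<open>Here \<open>L\<close> stands for ln (1/eps) and \<open>x\<close> for d + L, in the case
  where \<open>L\<close> dominates.\<close>

lemma parameter_choice:
  assumes L: "2 < L" and x: "4 \<le> x" "x \<le> 2 * L" "L \<le> x"
  obtains q r k :: nat where "k = 8 * q" "0 < q" "exp (- L) * (2 * real k ^ (2 * r)) < 1"
    "2 * (2 * real k ^ (2 * r) + 2) < (4/3) ^ q" "x / (40 * ln x) - 1 \<le> real r"
proof -
  \<comment> \<open>As ln (4/3) is at least 1/4, this \<open>q\<close> gives (4/3)^q at least exp (2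
    L), and \<open>r\<close> is chosen to keep k^(2r) below exp (L/2). Both conditions then follow
    from exp (L/2) > 2.\<close>
  define q where "q = nat \<lceil>8 * L\<rceil>"
  define k where "k = 8 * q"
  define r where "r = nat \<lfloor>L / (4 * ln (real k))\<rfloor>"
  have q: "8 * L \<le> real q" "real q \<le> 8 * L + 1" unfolding q_def using L by linarith+
  have q0: "0 < q" using q L by (cases q) auto
  have k: "real k = 8 * real q" by (simp add: k_def)
  then have k2: "2 \<le> real k" using q L by linarith
  then have lnk: "0 < ln (real k)" by simp
  \<comment> \<open>A polynomial bound on \<open>k\<close> makes ln k comparable to ln x.\<close>
  have "real k \<le> 68 * x" using k q L x by linarith
  also have "\<dots> \<le> x ^ 4 * x" using power_mono[of 4 x 4] x by (intro mult_right_mono) auto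
  also have "\<dots> = x ^ 5" by (simp add: eval_nat_numeral)
  finally have "ln (real k) \<le> ln (x ^ 5)" using k2 x by simp
  then have lnkx: "ln (real k) \<le> 5 * ln x" using x by (simp add: ln_realpow)
  have r: "real r \<le> L / (4 * ln (real k))" "L / (4 * ln (real k)) - 1 \<le> real r"
    unfolding r_def using L lnk by simp_all
  have kr: "real k ^ (2 * r) \<le> exp (L / 2)"
  proof -
    have "real k ^ (2 * r) = exp (real (2 * r) * ln (real k))"
      using exp_of_nat_mult[of "2 * r" "ln (real k)"] k2 by (simp del: of_nat_mult)
    also have "\<dots> \<le> exp (L / 2)" using r(1) lnk by (simp add: field_simps)
    finally show ?thesis .
  qed
  have e1: "2 < exp (1 :: real)" using exp_lower_Taylor_quadratic[of 1] by simp
  have eL: "2 < exp (L / 2)" using e1 L by (intro less_trans[OF e1]) simp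
  have "exp (- L) * (2 * real k ^ (2 * r)) \<le> exp (- L) * (2 * exp (L / 2))"
    using kr by simp
  also have "\<dots> < exp (- L) * (exp (L / 2) * exp (L / 2))" using eL by simp
  also have "\<dots> = 1" by (simp add: exp_add[symmetric])
  finally have 1: "exp (- L) * (2 * real k ^ (2 * r)) < 1" .
  have "1/4 \<le> ln (4/3 :: real)" using ln_le_minus_one[of "3/4 :: real"] by (simp add: ln_div)
  then have "2 * L \<le> real q * ln (4/3)"
    using mult_mono[of "8 * L" "real q" "1/4" "ln (4/3 :: real)"] q L by simp
  then have "exp (2 * L) \<le> exp (real q * ln (4/3))" by simp
  also have "\<dots> = (4/3) ^ q" by (simp add: exp_of_nat_mult)
  finally have E: "exp (2 * L) \<le> (4/3 :: real) ^ q" .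
  have "2 * (2 * real k ^ (2 * r) + 2) \<le> 4 * exp (L / 2) + 4" using kr by simp
  also have "\<dots> < exp (L / 2) * exp (L / 2) * exp (L / 2) * exp (L / 2)"
  proof -
    define e where "e = exp (L / 2)"
    have e: "2 < e" using eL by (simp add: e_def)
    have "2 * e < e * e" using e by simp
    then have "4 * e + 4 < 4 * (e * e)" using e by linarith
    also have "\<dots> < (e * e) * (e * e)"
      using mult_strict_mono[of 2 e 2 e] e by (intro mult_strict_right_mono) auto
    finally show ?thesis by (simp only: mult.assoc e_def)
  qed
  also have "\<dots> = exp (2 * L)" by (simp add: exp_add[symmetric])
  finally have 2: "2 * (2 * real k ^ (2 * r) + 2) < (4/3) ^ q" using E by linarith
  have "x / (40 * ln x) = (x / 2) / (4 * (5 * ln x))" by simp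
  also have "\<dots> \<le> L / (4 * ln (real k))"
    using lnk lnkx x L by (intro frac_le mult_left_mono) auto
  finally have 3: "x / (40 * ln x) - 1 \<le> real r" using r(2) by linarith
  show ?thesis by (rule that[OF k_def q0 1 2 3])
qed

theorem theorem1:
  shows "\<exists>\<alpha>::real. \<alpha> > 0 \<and> (\<exists>\<beta>::real.
     \<forall>d::nat. \<forall>eps::real. \<forall>P::real list protocol.
       d \<ge> 2 \<and> 0 < eps \<and> eps \<le> 1/3 \<and> learns_realizable d (halfspaces d) eps P \<longrightarrow>
       (\<exists>Sa Sb n. in_dom d Sa \<and> in_dom d Sb \<and> realizable (halfspaces d) (Sa @ Sb) \<and>
          halts_at P Sa Sb n \<and>
          real (length (trans P Sa Sb n)) \<ge>
            \<alpha> * (real d + ln (1 / eps)) / ln (real d + ln (1 / eps)) - \<beta>))"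
proof -
  define c where "c = 2/3 * ln 2 - ln (3/2 :: real)"
  \<comment> \<open>1/40 comes from \<open>parameter_choice\<close>. In c/4 one half is for d being
    at least x/2, the other for ln (2d+3) being at most 2 ln x. The rounding of \<open>r\<close> is
    absorbed by \<beta> = 1.\<close>
  define \<alpha> where "\<alpha> = min (1/40) (c/4)"
  \<comment> \<open>Positivity of \<open>c\<close> amounts to 27/8 < 4.\<close>
  have "ln ((3/2 :: real) ^ 3) < ln (2 ^ 2)" by (subst ln_less_cancel_iff) (auto simp: eval_nat_numeral)
  moreover have "ln ((3/2 :: real) ^ 3) = 3 * ln (3/2)" "ln ((2 :: real) ^ 2) = 2 * ln 2"
    by (subst ln_realpow; simp)+
  ultimately have c: "0 < c" unfolding c_def by argo
  then have \<alpha>: "0 < \<alpha>" "\<alpha> \<le> 1/40" "\<alpha> \<le> c/4" by (auto simp: \<alpha>_def)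
  have "\<exists>Sa Sb n. in_dom d Sa \<and> in_dom d Sb \<and> realizable (halfspaces d) (Sa @ Sb) \<and>
          halts_at P Sa Sb n \<and>
          \<alpha> * (real d + ln (1 / eps)) / ln (real d + ln (1 / eps)) - 1 \<le> real (length (trans P Sa Sb n))"
    if d: "2 \<le> d" and eps: "0 < eps" "eps \<le> 1/3" and P: "learns_realizable d (halfspaces d) eps P"
    for d :: nat and eps :: real and P
  proof -
    define L where "L = ln (1 / eps)"
    define x where "x = real d + L"
    have "3 \<le> 1 / eps" using eps by (simp add: field_simps)
    then have "exp 1 \<le> 1 / eps" using exp_le by linarith
    then have L1: "1 \<le> L" using eps by (simp add: L_def ln_ge_iff)
    have x3: "3 \<le> x" using d L1 by (simp add: x_def)
    then have lnx: "0 < ln x" by simp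
    have epsL: "eps = exp (- L)" using eps by (simp add: L_def ln_div)
    show ?thesis
    \<comment> \<open>The larger of the two summands is at least x/2, so the bound for that summand
      alone suffices.\<close>
    proof (cases "L \<le> real d")
      case True
      obtain Sa Sb n where *: "in_dom d Sa" "in_dom d Sb" "realizable (halfspaces d) (Sa @ Sb)"
        "halts_at P Sa Sb n" "real d * c \<le> real (length (trans P Sa Sb n)) * ln (2 * real d + 3)"
        using dim_bound[OF P eps(2)] unfolding c_def by blast
      let ?T = "real (length (trans P Sa Sb n))"
      have "2 * real d + 3 \<le> 3 * x" using x3 L1 by (simp add: x_def)
      also have "\<dots> \<le> x ^ 2" using x3 by (simp add: power2_eq_square)
      finally have "ln (2 * real d + 3) \<le> ln (x ^ 2)" using x3 by simp
      then have "ln (2 * real d + 3) \<le> 2 * ln x" using x3 by (simp add: ln_realpow)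
      then have "?T * ln (2 * real d + 3) \<le> ?T * (2 * ln x)" by (intro mult_left_mono) auto
      moreover have "x / 2 * c \<le> real d * c" using True c by (intro mult_right_mono) (auto simp: x_def)
      moreover have "\<alpha> * x \<le> c / 4 * x" using \<alpha> x3 by (intro mult_right_mono) auto
      ultimately have "\<alpha> * x \<le> ?T * ln x" using *(5) by argo
      then have "\<alpha> * x / ln x \<le> ?T" using lnx by (simp add: divide_le_eq)
      then have "\<alpha> * x / ln x - 1 \<le> ?T" by simp
      then show ?thesis using * unfolding x_def L_def by blast
    next
      case False
      then have "2 < L" "4 \<le> x" "x \<le> 2 * L" "L \<le> x" using d by (auto simp: x_def)
      then obtain q r k where p: "k = 8 * q" "0 < q" "exp (- L) * (2 * real k ^ (2 * r)) < 1"
        "2 * (2 * real k ^ (2 * r) + 2) < (4/3) ^ q" "x / (40 * ln x) - 1 \<le> real r"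
        by (rule parameter_choice)
      obtain Sa Sb n where *: "in_dom d Sa" "in_dom d Sb" "realizable (halfspaces d) (Sa @ Sb)"
        "halts_at P Sa Sb n" "r \<le> length (trans P Sa Sb n)"
        using eps_bound[OF d P p(1,2) eps(1) p(3)[folded epsL] p(4)] by blast
      have "\<alpha> * x / ln x \<le> 1/40 * x / ln x"
        using \<alpha> x3 lnx by (intro divide_right_mono mult_right_mono) auto
      then have "\<alpha> * x / ln x - 1 \<le> real (length (trans P Sa Sb n))" using p(5) *(5) by simp
      then show ?thesis using * unfolding x_def L_def by blast
    qed
  qed
  then show ?thesis using \<alpha>(1) by (intro exI[of _ \<alpha>] conjI exI[of _ 1]) auto
qed

end
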